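(* Let $\mathbb{K}$ be a ground ring containing $\mathbb{Q}$, let $\mathcal{A}$ be a localised ring over $\mathbb{K}$, and let $e\in\mathbb{M}_N(\mathcal{A})$ be an idempotent. Then $$Ch(e)=e+\frac{(-1)^1}{1!}\,e(de)^2+\frac{(-1)^2}{2!}\,e(de)^4+\dots+\frac{(-1)^n}{n!}\,e(de)^{2n}+\dots$$ is a cycle in the bi-complex $(\tilde b,d)$, i.e. $(\tilde b+d)\,Ch(e)=0$.
   Context: Localised ring: a unital associative ring $\mathcal{A}$ with a decreasing filtration by sub-spaces $\mathcal{A}_\mu$, $\mu\in\mathbb{N}$, such that $\mathbb{C}\cdot 1\subset\mathcal{A}_\mu$ for all $\mu$, $\mathcal{A}_\mu\cdot\mathcal{A}_{\mu'}\subset\mathcal{A}_{\min(\mu,\mu')-1}$ for $\mu,\mu'\ge1$, and $\mathcal{A}_0\cdot\mathcal{A}_0\subset\mathcal{A}_0$. For a unital ring $R$ (here $R=\mathbb{M}_N(\mathcal{A})$; no trace is used) let $C_n(R)=R^{\otimes(n+1)}$, let $b$ be the Hochschild boundary and $d(a_0\otimes\dots\otimes a_n)=\sum_{i=0}^{n+1}(-1)^i a_0\otimes\dots\otimes a_{i-1}\otimes1\otimes a_i\otimes\dots\otimes a_n$ the Alexander–Spanier co-boundary. In particular $da=1\otimes a-a\otimes 1$, and $a_0\,da_1\cdots da_n\in C_n(R)$ is formed with the product $(x_0\otimes\dots\otimes x_p)(y_0\otimes\dots\otimes y_q)=x_0\otimes\dots\otimes x_{p-1}\otimes x_py_0\otimes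 y_1\otimes\dots\otimes y_q$. The bi-complex $(\tilde b,d)$ is considered on normalised (non-degenerate) chains, i.e. on the range of the idempotent $\Pi_{(n)}=(1-bd)\sigma^n$ on $C_n$, with $\sigma=1-(db+bd)$. The modified Hochschild boundary is $\tilde b_n=b\sum_{k=1}^{n}(-1)^{k-1}\binom{n}{k}(db)^{k-1}$ on $C_n$, with $\tilde b_0=0$. The total ($\mathbb{Z}_2$-graded) complex consists of infinite sequences of chains of even (resp. odd) degree with boundary $\tilde b+d$. *)

theory Defs
  imports "HOL-Analysis.Analysis" "HOL-Algebra.Free_Abelian_Groups"
begin

section \<open>Ground ring, algebras and localised rings\<close>

text \<open>\<open>\<iota>\<close> exhibits the rationals as a subring of the ground ring.\<close>

definition rat_embedding :: "(rat \<Rightarrow> 'k::comm_ring_1) \<Rightarrow> bool" where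
  "rat_embedding \<iota> \<longleftrightarrow>
     inj \<iota> \<and> \<iota> 1 = 1 \<and> (\<forall>p q. \<iota> (p + q) = \<iota> p + \<iota> q) \<and> (\<forall>p q. \<iota> (p * q) = \<iota> p * \<iota> q)"

locale unital_algebra = Modules.module smul
  for smul :: "'k::comm_ring_1 \<Rightarrow> 'r::ring_1 \<Rightarrow> 'r" +
  assumes scale_mult_left: "smul c (x * y) = smul c x * y"
    and scale_mult_right: "smul c (x * y) = x * smul c y"

locale localised_ring = unital_algebra smul
  for smul :: "'k::comm_ring_1 \<Rightarrow> 'a::ring_1 \<Rightarrow> 'a" +
  fixes filt :: "nat \<Rightarrow> 'a set"
  assumes filt_subspace: "subspace (filt \<mu>)"
    and filt_decreasing: "decseq filt"
    and filt_scalars: "smul c 1 \<in> filt \<mu>"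
    and filt_mult: "1 \<le> \<mu> \<Longrightarrow> 1 \<le> \<nu> \<Longrightarrow> x \<in> filt \<mu> \<Longrightarrow> y \<in> filt \<nu> \<Longrightarrow> x * y \<in> filt (min \<mu> \<nu> - 1)"
    and filt_mult_zero: "x \<in> filt 0 \<Longrightarrow> y \<in> filt 0 \<Longrightarrow> x * y \<in> filt 0"


section \<open>The ring of square matrices\<close>

text \<open>
  On \<open>'a^'n^'n\<close> itself the class operation \<open>*\<close> is entrywise multiplication, so the matrix ring
  gets a type of its own.
\<close>

typedef ('a, 'n::finite) sqmat = "UNIV :: ('a^'n^'n) set"
  morphisms mat_of to_sqmat by simp

setup_lifting type_definition_sqmat

instantiation sqmat :: (ring_1, finite) ring_1
begin

lift_definition zero_sqmat :: "('a, 'b) sqmat" is "0" .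
lift_definition one_sqmat :: "('a, 'b) sqmat" is "mat 1" .
lift_definition plus_sqmat :: "('a, 'b) sqmat \<Rightarrow> ('a, 'b) sqmat \<Rightarrow> ('a, 'b) sqmat" is "(+)" .
lift_definition uminus_sqmat :: "('a, 'b) sqmat \<Rightarrow> ('a, 'b) sqmat" is "uminus" .
lift_definition minus_sqmat :: "('a, 'b) sqmat \<Rightarrow> ('a, 'b) sqmat \<Rightarrow> ('a, 'b) sqmat" is "(-)" .
lift_definition times_sqmat :: "('a, 'b) sqmat \<Rightarrow> ('a, 'b) sqmat \<Rightarrow> ('a, 'b) sqmat" is "(**)" .

instance
proof
  fix a b c :: "('a, 'b) sqmat"
  show "a * b * c = a * (b * c)"
    by transfer (simp add: matrix_mul_assoc)
  show "(a + b) * c = a * c + b * c"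
    by transfer (simp add: matrix_matrix_mult_def vec_eq_iff distrib_right sum.distrib)
  show "a * (b + c) = a * b + a * c"
    by transfer (simp add: matrix_add_ldistrib)
  show "(0::('a, 'b) sqmat) \<noteq> 1"
    by transfer (simp add: mat_def vec_eq_iff)
qed (transfer; simp)+

end

lift_definition mat_scale ::
  "('k \<Rightarrow> 'a \<Rightarrow> 'a) \<Rightarrow> 'k \<Rightarrow> ('a, 'n::finite) sqmat \<Rightarrow> ('a, 'n) sqmat"
  is "\<lambda>smul c A. \<chi> i j. smul c (A $ i $ j)" .

lemma unital_algebra_mat_scale:
  assumes "unital_algebra smul"
  shows "unital_algebra (mat_scale smul :: 'k::comm_ring_1 \<Rightarrow> ('a::ring_1, 'n::finite) sqmat \<Rightarrow> _)"
proof -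
  interpret unital_algebra smul by fact
  note rep = mat_of_inject[symmetric] mat_scale.rep_eq plus_sqmat.rep_eq times_sqmat.rep_eq vec_eq_iff
  show ?thesis
  proof
    fix c d :: 'k and x y :: "('a, 'n) sqmat"
    show "mat_scale smul c (x + y) = mat_scale smul c x + mat_scale smul c y"
      by (simp add: rep scale_right_distrib)
    show "mat_scale smul (c + d) x = mat_scale smul c x + mat_scale smul d x"
      by (simp add: rep scale_left_distrib)
    show "mat_scale smul c (mat_scale smul d x) = mat_scale smul (c * d) x"
      by (simp add: rep)
    show "mat_scale smul 1 x = x"
      by (simp add: rep)
    show "mat_scale smul c (x * y) = mat_scale smul c x * y"
      by (simp add: rep matrix_matrix_mult_def scale_sum_right scale_mult_left)
    show "mat_scale smul c (x * y) = x * mat_scale smul c y"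
      by (simp add: rep matrix_matrix_mult_def scale_sum_right scale_mult_right)
  qed
qed


section \<open>Tensor powers over the ground ring\<close>

text \<open>
  The pure tensor \<open>a\<^sub>0 \<otimes> \<dots> \<otimes> a\<^sub>n\<close> is encoded by the list \<open>[a\<^sub>0, \<dots>, a\<^sub>n]\<close>.  The tensor power
  \<open>C\<^sub>n(R)\<close>, the \<open>(n + 1)\<close>-fold one, is the free Abelian group on these lists modulo additivity
  in each slot and the balancing relation \<open>\<dots> \<otimes> cx \<otimes> y \<otimes> \<dots> = \<dots> \<otimes> x \<otimes> cy \<otimes> \<dots>\<close>.
  The groups come from HOL-Algebra, so their addition is written \<open>\<otimes>\<close> and their zero \<open>\<one>\<close>.
\<close>

definition tensor_free :: "nat \<Rightarrow> ('r list \<Rightarrow>\<^sub>0 int) monoid" where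
  "tensor_free n = free_Abelian_group {xs. length xs = Suc n}"

definition tensor_relators :: "('k \<Rightarrow> 'r::ring_1 \<Rightarrow> 'r) \<Rightarrow> nat \<Rightarrow> ('r list \<Rightarrow>\<^sub>0 int) set" where
  "tensor_relators smul n =
     {frag_of (us @ [x + y] @ vs) - frag_of (us @ [x] @ vs) - frag_of (us @ [y] @ vs) | us x y vs.
        length us + length vs = n} \<union>
     {frag_of (us @ [smul c x, y] @ vs) - frag_of (us @ [x, smul c y] @ vs) | us c x y vs.
        Suc (length us + length vs) = n}"

definition tensor_kernel :: "('k \<Rightarrow> 'r::ring_1 \<Rightarrow> 'r) \<Rightarrow> nat \<Rightarrow> ('r list \<Rightarrow>\<^sub>0 int) set" where
  "tensor_kernel smul n = generate (tensor_free n) (tensor_relators smul n)"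

definition chain_group :: "('k \<Rightarrow> 'r::ring_1 \<Rightarrow> 'r) \<Rightarrow> nat \<Rightarrow> ('r list \<Rightarrow>\<^sub>0 int) set monoid" where
  "chain_group smul n = tensor_free n Mod tensor_kernel smul n"

definition chain_class ::
  "('k \<Rightarrow> 'r::ring_1 \<Rightarrow> 'r) \<Rightarrow> nat \<Rightarrow> ('r list \<Rightarrow>\<^sub>0 int) \<Rightarrow> ('r list \<Rightarrow>\<^sub>0 int) set" where
  "chain_class smul n x = tensor_kernel smul n #>\<^bsub>tensor_free n\<^esub> x"

text \<open>
  The map into \<open>C\<^sub>m(R)\<close> induced by a map of representatives: when the latter respects the
  relations, all members of the union below coincide.
\<close>

definition induced ::
  "('k \<Rightarrow> 'r::ring_1 \<Rightarrow> 'r) \<Rightarrow> nat \<Rightarrow> (('r list \<Rightarrow>\<^sub>0 int) \<Rightarrow> ('r list \<Rightarrow>\<^sub>0 int)) \<Rightarrow>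
   ('r list \<Rightarrow>\<^sub>0 int) set \<Rightarrow> ('r list \<Rightarrow>\<^sub>0 int) set" where
  "induced smul m f X = (\<Union>x\<in>X. chain_class smul m (f x))"


section \<open>Operators on representatives\<close>

definition hochschild_list :: "'r::ring_1 list \<Rightarrow> ('r list \<Rightarrow>\<^sub>0 int)" where
  "hochschild_list xs =
     (if length xs \<le> 1 then 0
      else (\<Sum>i<length xs - 1. frag_cmul ((-1) ^ i)
              (frag_of (take i xs @ [xs ! i * xs ! Suc i] @ drop (i + 2) xs)))
         + frag_cmul ((-1) ^ (length xs - 1)) (frag_of ((last xs * hd xs) # butlast (tl xs))))"

definition hochschild :: "('r::ring_1 list \<Rightarrow>\<^sub>0 int) \<Rightarrow> ('r list \<Rightarrow>\<^sub>0 int)" where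
  "hochschild = frag_extend hochschild_list"

definition alexander_spanier :: "('r::ring_1 list \<Rightarrow>\<^sub>0 int) \<Rightarrow> ('r list \<Rightarrow>\<^sub>0 int)" where
  "alexander_spanier = frag_extend
     (\<lambda>xs. \<Sum>i\<le>length xs. frag_cmul ((-1) ^ i) (frag_of (take i xs @ [1] @ drop i xs)))"

definition sigma :: "('r::ring_1 list \<Rightarrow>\<^sub>0 int) \<Rightarrow> ('r list \<Rightarrow>\<^sub>0 int)" where
  "sigma x = x - (alexander_spanier (hochschild x) + hochschild (alexander_spanier x))"

definition normaliser :: "nat \<Rightarrow> ('r::ring_1 list \<Rightarrow>\<^sub>0 int) \<Rightarrow> ('r list \<Rightarrow>\<^sub>0 int)" where
  "normaliser n x = (sigma ^^ n) x - hochschild (alexander_spanier ((sigma ^^ n) x))"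

text \<open>For \<open>n = 0\<close> the sum is empty, in accordance with the convention that this operator is 0.\<close>

definition mod_hochschild :: "nat \<Rightarrow> ('r::ring_1 list \<Rightarrow>\<^sub>0 int) \<Rightarrow> ('r list \<Rightarrow>\<^sub>0 int)" where
  "mod_hochschild n x = hochschild
     (\<Sum>k=1..n. frag_cmul ((-1) ^ (k - 1) * int (n choose k))
                  (((alexander_spanier \<circ> hochschild) ^^ (k - 1)) x))"

definition chain_mult ::
  "('r::ring_1 list \<Rightarrow>\<^sub>0 int) \<Rightarrow> ('r list \<Rightarrow>\<^sub>0 int) \<Rightarrow> ('r list \<Rightarrow>\<^sub>0 int)" where
  "chain_mult x y = frag_extend
     (\<lambda>xs. frag_extend (\<lambda>ys. frag_of (butlast xs @ [last xs * hd ys] @ tl ys)) y) x"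

text \<open>Scalars act on a tensor through any one of its slots; the first one is used here.\<close>

definition chain_scale ::
  "('k \<Rightarrow> 'r::ring_1 \<Rightarrow> 'r) \<Rightarrow> 'k \<Rightarrow> ('r list \<Rightarrow>\<^sub>0 int) \<Rightarrow> ('r list \<Rightarrow>\<^sub>0 int)" where
  "chain_scale smul c = frag_extend (\<lambda>xs. frag_of (smul c (hd xs) # tl xs))"


section \<open>The total complex of the bi-complex\<close>

definition normalised_chains :: "('k \<Rightarrow> 'r::ring_1 \<Rightarrow> 'r) \<Rightarrow> nat \<Rightarrow> ('r list \<Rightarrow>\<^sub>0 int) set set" where
  "normalised_chains smul n = induced smul n (normaliser n) ` carrier (chain_group smul n)"

text \<open>
  Elements of the total complex are indexed by all degrees; those of the even (odd) part vanish in
  all odd (even) degrees.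
\<close>

definition total_complex ::
  "('k \<Rightarrow> 'r::ring_1 \<Rightarrow> 'r) \<Rightarrow> bool \<Rightarrow> (nat \<Rightarrow> ('r list \<Rightarrow>\<^sub>0 int) set) set" where
  "total_complex smul ev =
     {c. \<forall>n. if even n = ev then c n \<in> normalised_chains smul n
             else c n = \<one>\<^bsub>chain_group smul n\<^esub>}"

definition total_boundary ::
  "('k \<Rightarrow> 'r::ring_1 \<Rightarrow> 'r) \<Rightarrow> (nat \<Rightarrow> ('r list \<Rightarrow>\<^sub>0 int) set) \<Rightarrow> nat \<Rightarrow> ('r list \<Rightarrow>\<^sub>0 int) set" where
  "total_boundary smul c n =
     induced smul n (mod_hochschild (Suc n)) (c (Suc n))
     \<otimes>\<^bsub>chain_group smul n\<^esub>
     (if n = 0 then \<one>\<^bsub>chain_group smul n\<^esub> else induced smul n alexander_spanier (c (n - 1)))"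

definition total_cycle ::
  "('k \<Rightarrow> 'r::ring_1 \<Rightarrow> 'r) \<Rightarrow> bool \<Rightarrow> (nat \<Rightarrow> ('r list \<Rightarrow>\<^sub>0 int) set) \<Rightarrow> bool" where
  "total_cycle smul ev c \<longleftrightarrow>
     c \<in> total_complex smul ev \<and> (\<forall>n. total_boundary smul c n = \<one>\<^bsub>chain_group smul n\<^esub>)"


section \<open>The Chern character of an idempotent\<close>

text \<open>A representative of \<open>e (de)\<^sup>m\<close>.\<close>

definition e_de_power :: "'r::ring_1 \<Rightarrow> nat \<Rightarrow> ('r list \<Rightarrow>\<^sub>0 int)" where
  "e_de_power e m = ((\<lambda>x. chain_mult x (alexander_spanier (frag_of [e]))) ^^ m) (frag_of [e])"

definition chern ::
  "(rat \<Rightarrow> 'k) \<Rightarrow> ('k \<Rightarrow> 'r::ring_1 \<Rightarrow> 'r) \<Rightarrow> 'r \<Rightarrow> nat \<Rightarrow> ('r list \<Rightarrow>\<^sub>0 int) set" where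
  "chern \<iota> smul e m =
     (if even m
      then chain_class smul m
             (chain_scale smul (\<iota> ((-1) ^ (m div 2) / fact (m div 2))) (e_de_power e m))
      else \<one>\<^bsub>chain_group smul m\<^esub>)"

end

theory Submission
  imports Defs
begin

text \<open>
  Write \<open>P\<^sub>a m = a (de)\<^sup>m\<close>.  The element \<open>de = 1 \<otimes> e - e \<otimes> 1\<close> is killed by the bar part \<open>b'\<close> of the
  Hochschild boundary (all faces but the cyclic one), and \<open>b'\<close> is compatible with right
  multiplication by \<open>de\<close>.  So \<open>b'\<close> vanishes on every \<open>P\<^sub>a m\<close>, and only the commutator
  \<open>b (P\<^sub>a (m + 1)) = (-1)\<^sup>m [P\<^sub>a m, e]\<close> survives.  As \<open>e\<close> is idempotent, \<open>(de) e = (1 - e) de\<close>, and the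
  commutator is computed by moving \<open>e\<close> through the factors \<open>de\<close> (\<open>hochschild_de_form\<close>).

  Let \<open>\<omega> m = c e (de)\<^sup>m\<close> and \<open>\<eta> m = c (de)\<^sup>m\<close> for a scalar \<open>c\<close>.  For even \<open>m > 0\<close> the result is
  \<open>b (\<omega> m) = \<omega> (m - 1)\<close> and \<open>b (\<eta> m) = 2 \<omega> (m - 1) - \<eta> (m - 1)\<close>, while \<open>b\<close> vanishes on odd forms.
  As \<open>d\<close> is a derivation with \<open>dd = 0\<close>, also \<open>d (\<omega> m) = \<eta> (m + 1)\<close> and \<open>d (\<eta> m) = 0\<close>.
  Hence \<open>db (\<omega> m) = \<eta> m\<close> and \<open>db (\<eta> m) = 2 \<eta> m\<close>, so all the powers of \<open>db\<close> in the modified boundary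
  are known, and a binomial sum gives
  \<open>\<tilde>b (\<omega> (2n)) = b (2n \<omega> (2n) - n \<eta> (2n)) = n \<eta> (2n - 1)\<close> (\<open>mod_hochschild_\<omega>\<close>).
  With \<open>c\<^sub>n = (-1)\<^sup>n / n!\<close> one has \<open>n c\<^sub>n + c\<^sub>n\<^sub>-\<^sub>1 = 0\<close>: the modified boundary of each component of the
  character cancels the co-boundary of the preceding one.  The components are normalised because
  \<open>bd\<close> kills \<open>\<omega> (2n)\<close> and \<open>\<sigma>\<close> acts on the span of \<open>\<omega> (2n)\<close>, \<open>\<eta> (2n)\<close> by \<open>\<omega> \<mapsto> \<omega> - \<eta>\<close>,
  \<open>\<eta> \<mapsto> -\<eta>\<close>, an involution if \<open>n > 0\<close>, so that its even power \<open>\<sigma>\<^sup>2\<^sup>n\<close> is the identity there.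

  The boundary \<open>b\<close> and the multiplications use only the product of the ring, so the formulas for \<open>b\<close>
  hold exactly for integral combinations of lists.  The tensor relations enter when \<open>d\<close> meets the scalar
  \<open>c\<close> and when scalar multiples are added up; for this, all operators must respect the relations.
  Both parts rest on the same device: a list of positive length is a shorter list with one more slot
  appended, every operator has a simple rule for an appended slot, and the relations themselves
  are generated by relations in the last one or two slots, carried along by appending
  (\<open>tensor_kernel_iff\<close>).
\<close>

section \<open>Operators and the last slot of a chain\<close>

text \<open>
  The lists in \<open>homog k\<close> have length \<open>k\<close>, so these are the representatives of degree \<open>k - 1\<close>. Counting
  by length leaves room for the empty list, from which chains are built slot by slot.
\<close>

definition homog :: "nat \<Rightarrow> ('r list \<Rightarrow>\<^sub>0 int) set" where
  "homog k = {x. Poly_Mapping.keys x \<subseteq> {xs. length xs = k}}"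

lemma homog_zero [simp]: "0 \<in> homog k"
  by (simp add: homog_def)

lemma homog_frag_of [simp]: "frag_of xs \<in> homog k \<longleftrightarrow> length xs = k"
  by (simp add: homog_def)

lemma homog_diff: "x \<in> homog k \<Longrightarrow> y \<in> homog k \<Longrightarrow> x - y \<in> homog k"
  using keys_diff[of x y] by (auto simp: homog_def)

lemma homog_minus: "x \<in> homog k \<Longrightarrow> - x \<in> homog k"
  using homog_diff[of 0 k x] by simp

lemma homog_add: "x \<in> homog k \<Longrightarrow> y \<in> homog k \<Longrightarrow> x + y \<in> homog k"
  using homog_diff[of x k "- y"] homog_minus[of y k] by simp

lemma homog_cmul: "x \<in> homog k \<Longrightarrow> frag_cmul c x \<in> homog k"
  by (auto simp: homog_def)

lemma homog_sum: "(\<And>i. i \<in> I \<Longrightarrow> f i \<in> homog k) \<Longrightarrow> sum f I \<in> homog k"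
  by (induction I rule: infinite_finite_induct) (auto intro: homog_add)

lemmas homog_intros = homog_add homog_diff homog_minus homog_cmul homog_sum

lemma homog_frag_extend:
  assumes "\<And>xs. length xs = k \<Longrightarrow> f xs \<in> homog m" "x \<in> homog k"
  shows "frag_extend f x \<in> homog m"
  using assms keys_frag_extend[of f x] unfolding homog_def by blast

lemma homog_induct [consumes 1, case_names zero one diff]:
  assumes "x \<in> homog k" "P 0" "\<And>xs. length xs = k \<Longrightarrow> P (frag_of xs)"
    and "\<And>x y. P x \<Longrightarrow> P y \<Longrightarrow> P (x - y)"
  shows "P x"
proof -
  have "Poly_Mapping.keys x \<subseteq> {xs. length xs = k}"
    using assms(1) by (simp add: homog_def)
  then show ?thesis
    by (induction x rule: frag_induction) (auto intro: assms)
qed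

definition snoc :: "'r \<Rightarrow> ('r list \<Rightarrow>\<^sub>0 int) \<Rightarrow> ('r list \<Rightarrow>\<^sub>0 int)" where
  "snoc z = frag_extend (\<lambda>xs. frag_of (xs @ [z]))"

definition right_act :: "'r::ring_1 \<Rightarrow> ('r list \<Rightarrow>\<^sub>0 int) \<Rightarrow> ('r list \<Rightarrow>\<^sub>0 int)" where
  "right_act z = frag_extend (\<lambda>xs. frag_of (butlast xs @ [last xs * z]))"

definition left_act :: "'r::ring_1 \<Rightarrow> ('r list \<Rightarrow>\<^sub>0 int) \<Rightarrow> ('r list \<Rightarrow>\<^sub>0 int)" where
  "left_act z = frag_extend (\<lambda>xs. frag_of ((z * hd xs) # tl xs))"

text \<open>
  The summands of \<open>hochschild_list\<close> other than the cyclic one.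
\<close>

definition bar_list :: "'r::ring_1 list \<Rightarrow> ('r list \<Rightarrow>\<^sub>0 int)" where
  "bar_list xs = (\<Sum>i<length xs - 1. frag_cmul ((-1) ^ i)
     (frag_of (take i xs @ [xs ! i * xs ! Suc i] @ drop (i + 2) xs)))"

definition bar_boundary :: "('r::ring_1 list \<Rightarrow>\<^sub>0 int) \<Rightarrow> ('r list \<Rightarrow>\<^sub>0 int)" where
  "bar_boundary = frag_extend bar_list"

definition times_d :: "'r::ring_1 \<Rightarrow> ('r list \<Rightarrow>\<^sub>0 int) \<Rightarrow> ('r list \<Rightarrow>\<^sub>0 int)" where
  "times_d e x = chain_mult x (alexander_spanier (frag_of [e]))"

lemmas operator_defs = snoc_def right_act_def left_act_def bar_boundary_def hochschild_def
  alexander_spanier_def times_d_def chain_mult_def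

lemma operators_zero [simp]:
  "snoc z 0 = 0" "right_act z 0 = 0" "left_act z 0 = 0" "bar_boundary 0 = 0" "hochschild 0 = 0"
  "alexander_spanier 0 = 0" "times_d z 0 = 0"
  by (simp_all add: operator_defs)

lemma operators_diff:
  "snoc z (x - y) = snoc z x - snoc z y" "right_act z (x - y) = right_act z x - right_act z y"
  "left_act z (x - y) = left_act z x - left_act z y"
  "bar_boundary (x - y) = bar_boundary x - bar_boundary y"
  "hochschild (x - y) = hochschild x - hochschild y"
  "alexander_spanier (x - y) = alexander_spanier x - alexander_spanier y"
  "times_d z (x - y) = times_d z x - times_d z y"
  by (simp_all add: operator_defs frag_extend_diff)

lemma operators_add:
  "snoc z (x + y) = snoc z x + snoc z y" "right_act z (x + y) = right_act z x + right_act z y"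
  "left_act z (x + y) = left_act z x + left_act z y"
  "bar_boundary (x + y) = bar_boundary x + bar_boundary y"
  "hochschild (x + y) = hochschild x + hochschild y"
  "alexander_spanier (x + y) = alexander_spanier x + alexander_spanier y"
  "times_d z (x + y) = times_d z x + times_d z y"
  by (simp_all add: operator_defs frag_extend_add)

lemma operators_cmul:
  "snoc z (frag_cmul c x) = frag_cmul c (snoc z x)"
  "right_act z (frag_cmul c x) = frag_cmul c (right_act z x)"
  "left_act z (frag_cmul c x) = frag_cmul c (left_act z x)"
  "bar_boundary (frag_cmul c x) = frag_cmul c (bar_boundary x)"
  "hochschild (frag_cmul c x) = frag_cmul c (hochschild x)"
  "alexander_spanier (frag_cmul c x) = frag_cmul c (alexander_spanier x)"
  "times_d z (frag_cmul c x) = frag_cmul c (times_d z x)"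
  by (simp_all add: operator_defs frag_extend_cmul)

lemma frag_cmul_diff2: "frag_cmul c (x - y) = frag_cmul c x - frag_cmul c (y :: 'a \<Rightarrow>\<^sub>0 int)"
  using frag_cmul_distrib2[of c x "- y"] frag_cmul_cmul[of c "-1" y] frag_cmul_cmul[of "-1" c y]
  by simp

lemma snoc_frag_of [simp]: "snoc z (frag_of xs) = frag_of (xs @ [z])"
  by (simp add: snoc_def)

lemma right_act_frag_of: "right_act z (frag_of xs) = frag_of (butlast xs @ [last xs * z])"
  by (simp add: right_act_def)

lemma left_act_frag_of: "left_act z (frag_of xs) = frag_of ((z * hd xs) # tl xs)"
  by (simp add: left_act_def)

lemma homog_snoc: "x \<in> homog k \<Longrightarrow> snoc z x \<in> homog (Suc k)"
  unfolding snoc_def by (rule homog_frag_extend[rotated]) auto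

lemma homog_right_act: "x \<in> homog (Suc k) \<Longrightarrow> right_act z x \<in> homog (Suc k)"
  unfolding right_act_def by (rule homog_frag_extend[rotated]) auto

lemma homog_left_act: "x \<in> homog (Suc k) \<Longrightarrow> left_act z x \<in> homog (Suc k)"
  unfolding left_act_def by (rule homog_frag_extend[rotated]) auto

lemma homog_bar_boundary: "x \<in> homog (Suc k) \<Longrightarrow> bar_boundary x \<in> homog k"
  unfolding bar_boundary_def
  by (rule homog_frag_extend[rotated]) (auto simp: bar_list_def intro!: homog_intros)

lemma homog_alexander_spanier: "x \<in> homog k \<Longrightarrow> alexander_spanier x \<in> homog (Suc k)"
  unfolding alexander_spanier_def
  by (rule homog_frag_extend[rotated]) (auto intro!: homog_intros)

text \<open>A chain of positive length ends in a slot, so an identity of additive operators follows once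
  it holds on the chains \<open>snoc z x\<close>.\<close>

lemma homog_Suc_induct [consumes 1, case_names zero snoc diff]:
  assumes "x \<in> homog (Suc k)" "P 0"
    and "\<And>z x. x \<in> homog k \<Longrightarrow> P (snoc z x)"
    and "\<And>x y. P x \<Longrightarrow> P y \<Longrightarrow> P (x - y)"
  shows "P x"
  using assms(1)
proof (induction x rule: homog_induct)
  case (one xs)
  then obtain ys z where "xs = ys @ [z]" "length ys = k"
    by (metis length_append_singleton length_Suc_conv_rev)
  then show ?case
    using assms(3)[of "frag_of ys" z] by simp
qed (use assms in auto)

lemma right_act_snoc: "right_act z (snoc y x) = snoc (y * z) x"
proof -
  have "x \<in> {x. right_act z (snoc y x) = snoc (y * z) x}"
    by (rule frag_induction[OF subset_UNIV])
       (simp_all add: operators_diff right_act_frag_of)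
  then show ?thesis by simp
qed

lemma left_act_snoc: "x \<in> homog (Suc k) \<Longrightarrow> left_act z (snoc y x) = snoc y (left_act z x)"
proof (induction x rule: homog_induct)
  case (one xs)
  then show ?case by (cases xs) (simp_all add: left_act_frag_of)
qed (simp_all add: operators_diff)

lemma left_act_snoc_0: "x \<in> homog 0 \<Longrightarrow> left_act z (snoc y x) = snoc (z * y) x"
  by (induction x rule: homog_induct) (simp_all add: operators_diff left_act_frag_of)

text \<open>
  The insertions of \<open>1\<close> before and directly in front of \<open>z\<close> form \<open>d x\<close> with \<open>z\<close> appended; only the
  insertion after \<open>z\<close> is new.
\<close>

lemma alexander_spanier_snoc:
  "x \<in> homog k \<Longrightarrow>
   alexander_spanier (snoc z x) = snoc z (alexander_spanier x) - frag_cmul ((-1) ^ k) (snoc 1 (snoc z x))"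
proof (induction x rule: homog_induct)
  case (one xs)
  have "(\<Sum>i\<le>k. frag_cmul ((-1) ^ i) (frag_of (take i (xs @ [z]) @ [1] @ drop i (xs @ [z])))) =
        (\<Sum>i\<le>k. snoc z (frag_cmul ((-1) ^ i) (frag_of (take i xs @ [1] @ drop i xs))))"
    using one by (intro sum.cong) (auto simp: operators_cmul)
  then show ?case
    using one by (simp add: alexander_spanier_def snoc_def frag_extend_sum o_def)
qed (simp_all add: operators_diff frag_cmul_diff2)

text \<open>
  Only the face that multiplies \<open>z\<close> into the preceding slot is new.
\<close>

lemma bar_boundary_snoc:
  "x \<in> homog (Suc k) \<Longrightarrow>
   bar_boundary (snoc z x) = snoc z (bar_boundary x) + frag_cmul ((-1) ^ k) (right_act z x)"
proof (induction x rule: homog_induct)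
  case (one xs)
  then obtain ys y where xs: "xs = ys @ [y]" "length ys = k"
    by (metis length_append_singleton length_Suc_conv_rev)
  have "(\<Sum>i<k. frag_cmul ((-1) ^ i)
          (frag_of (take i (xs @ [z]) @ [(xs @ [z]) ! i * (xs @ [z]) ! Suc i] @ drop (i + 2) (xs @ [z])))) =
        (\<Sum>i<k. snoc z (frag_cmul ((-1) ^ i)
          (frag_of (take i xs @ [xs ! i * xs ! Suc i] @ drop (i + 2) xs))))"
    using one by (intro sum.cong) (auto simp: operators_cmul nth_append)
  then show ?case
    using one xs
    by (simp add: bar_boundary_def bar_list_def snoc_def right_act_def frag_extend_sum o_def nth_append)
qed (simp_all add: operators_diff frag_cmul_diff2 algebra_simps)

lemma bar_boundary_length_one: "x \<in> homog (Suc 0) \<Longrightarrow> bar_boundary x = 0"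
  by (induction x rule: homog_induct) (simp_all add: bar_boundary_def bar_list_def frag_extend_diff)

lemma hochschild_length_one: "x \<in> homog (Suc 0) \<Longrightarrow> hochschild x = 0"
  by (induction x rule: homog_induct) (simp_all add: hochschild_def hochschild_list_def frag_extend_diff)

lemma hochschild_snoc:
  "x \<in> homog (Suc k) \<Longrightarrow>
   hochschild (snoc z x) = bar_boundary (snoc z x) - frag_cmul ((-1) ^ k) (left_act z x)"
proof (induction x rule: homog_induct)
  case (one xs)
  then show ?case
    by (cases xs) (simp_all add: hochschild_def hochschild_list_def bar_boundary_def bar_list_def left_act_def)
qed (simp_all add: operators_diff frag_cmul_diff2 algebra_simps)

lemma times_d_eq: "x \<in> homog (Suc k) \<Longrightarrow> times_d e x = snoc e x - snoc 1 (right_act e x)"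
proof (induction x rule: homog_induct)
  case (one xs)
  then show ?case
    by (cases xs rule: rev_cases)
       (simp_all add: times_d_def chain_mult_def alexander_spanier_def right_act_def frag_extend_diff)
qed (simp_all add: operators_diff)

lemma homog_times_d: "x \<in> homog (Suc k) \<Longrightarrow> times_d e x \<in> homog (Suc (Suc k))"
  by (simp add: times_d_eq homog_diff homog_snoc homog_right_act)

section \<open>Right multiplication by the differential of an element\<close>

lemma right_act_right_act: "x \<in> homog (Suc k) \<Longrightarrow> right_act z (right_act y x) = right_act (y * z) x"
  by (induction x rule: homog_Suc_induct) (simp_all add: operators_diff right_act_snoc mult.assoc)

lemma right_act_one: "x \<in> homog (Suc k) \<Longrightarrow> right_act 1 x = x"
  by (induction x rule: homog_Suc_induct) (simp_all add: operators_diff right_act_snoc)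

text \<open>
  The Leibniz rule \<open>d (x e) = (d x) e + (-1)\<^sup>k x de\<close>.
\<close>

lemma alexander_spanier_right_act:
  "x \<in> homog (Suc k) \<Longrightarrow>
   alexander_spanier (right_act e x) =
   right_act e (alexander_spanier x) + frag_cmul ((-1) ^ k) (times_d e x)"
proof (induction x rule: homog_Suc_induct)
  case (snoc z x)
  then show ?case
    by (simp add: right_act_snoc alexander_spanier_snoc operators_diff operators_cmul times_d_eq[OF homog_snoc]
        frag_cmul_diff2 algebra_simps)
qed (simp_all add: operators_diff frag_cmul_diff2 algebra_simps)

text \<open>
  The Leibniz rule again, now with \<open>d (de) = 0\<close>.
\<close>

lemma alexander_spanier_times_d:
  assumes "x \<in> homog (Suc k)"
  shows "alexander_spanier (times_d e x) = times_d e (alexander_spanier x)"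
  using assms
  by (simp add: times_d_eq times_d_eq[OF homog_alexander_spanier[OF assms]] operators_diff alexander_spanier_snoc[of _ "Suc k"]
      homog_right_act alexander_spanier_right_act operators_add operators_cmul frag_cmul_diff2)

lemma bar_boundary_right_act:
  assumes "x \<in> homog (Suc k)"
  shows "bar_boundary (right_act e x) = right_act e (bar_boundary x)"
proof (cases k)
  case 0
  then show ?thesis using assms by (simp add: bar_boundary_length_one homog_right_act)
next
  case (Suc m)
  show ?thesis using assms unfolding Suc
  proof (induction x rule: homog_Suc_induct)
    case (snoc z x)
    then show ?case
      by (simp add: right_act_snoc bar_boundary_snoc operators_add operators_cmul right_act_right_act)
  qed (simp_all add: operators_diff)
qed

text \<open>
  In \<open>x de\<close> the face between \<open>x\<close> and the new slot is \<open>xe\<close> for both summands of \<open>de\<close> and cancels; the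
  faces inside \<open>x\<close> are untouched.
\<close>

lemma bar_boundary_times_d:
  assumes "x \<in> homog (Suc (Suc k))"
  shows "bar_boundary (times_d e x) = times_d e (bar_boundary x)"
  using assms
  by (simp add: times_d_eq[OF assms] times_d_eq[OF homog_bar_boundary[OF assms]] operators_diff
      bar_boundary_snoc[OF assms] bar_boundary_snoc[OF homog_right_act[OF assms]]
      bar_boundary_right_act[OF assms] right_act_one[OF homog_right_act[OF assms]])

lemma bar_boundary_times_d_0:
  assumes "x \<in> homog (Suc 0)"
  shows "bar_boundary (times_d e x) = 0"
  using assms
  by (simp add: times_d_eq[OF assms] operators_diff
      bar_boundary_snoc[OF assms] bar_boundary_snoc[OF homog_right_act[OF assms]]
      bar_boundary_right_act[OF assms] right_act_one[OF homog_right_act[OF assms]] bar_boundary_length_one)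

lemma left_act_right_act:
  assumes "x \<in> homog (Suc k)"
  shows "left_act z (right_act e x) = right_act e (left_act z x)"
proof (cases k)
  case 0
  show ?thesis using assms unfolding 0
    by (induction x rule: homog_Suc_induct)
       (simp_all add: operators_diff right_act_snoc left_act_snoc_0 mult.assoc)
next
  case (Suc m)
  show ?thesis using assms unfolding Suc
    by (induction x rule: homog_Suc_induct)
       (simp_all add: operators_diff right_act_snoc left_act_snoc)
qed

lemma left_act_times_d:
  assumes "x \<in> homog (Suc k)"
  shows "left_act z (times_d e x) = times_d e (left_act z x)"
  by (simp add: times_d_eq[OF assms] times_d_eq[OF homog_left_act[OF assms]] operators_diff
      left_act_snoc[OF assms] left_act_snoc[OF homog_right_act[OF assms]] left_act_right_act[OF assms])

text \<open>
  This is \<open>(de) e = de - e de\<close>, the Leibniz rule applied to \<open>e e = e\<close>.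
\<close>

lemma right_act_times_d:
  assumes "x \<in> homog (Suc k)" "e * e = e"
  shows "right_act e (times_d e x) = times_d e x - times_d e (right_act e x)"
  using assms
  by (simp add: times_d_eq times_d_eq[OF homog_right_act] operators_diff right_act_snoc
      right_act_right_act)

lemma left_act_one: "x \<in> homog (Suc k) \<Longrightarrow> left_act 1 x = x"
proof (induction x rule: homog_induct)
  case (one xs)
  then show ?case by (cases xs) (simp_all add: left_act_frag_of)
qed (simp_all add: operators_diff)

text \<open>
  The cyclic face moves the last slot of \<open>x de = x \<otimes> e - xe \<otimes> 1\<close> to the front, which gives \<open>ex\<close>
  and \<open>xe\<close>.
\<close>

lemma hochschild_times_d:
  assumes "x \<in> homog (Suc k)"
  shows "hochschild (times_d e x) =
    bar_boundary (times_d e x) + frag_cmul ((-1) ^ k) (right_act e x - left_act e x)"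
  using assms
  by (simp add: times_d_eq operators_diff hochschild_snoc hochschild_snoc[OF homog_right_act]
      left_act_one[OF homog_right_act] frag_cmul_diff2)

section \<open>Powers of the differential of an idempotent\<close>

text \<open>
  The form \<open>a (de)\<^sup>m\<close>. The coefficient \<open>a\<close> is kept general because both \<open>a = ce\<close> and \<open>a = c\<close>, for a
  scalar \<open>c\<close>, occur.
\<close>

definition de_form :: "'r::ring_1 \<Rightarrow> 'r \<Rightarrow> nat \<Rightarrow> ('r list \<Rightarrow>\<^sub>0 int)" where
  "de_form e a m = (times_d e ^^ m) (frag_of [a])"

lemma de_form_0: "de_form e a 0 = frag_of [a]"
  and de_form_Suc: "de_form e a (Suc m) = times_d e (de_form e a m)"
  by (simp_all add: de_form_def)

lemma homog_de_form: "de_form e a m \<in> homog (Suc m)"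
  by (induction m) (simp_all add: de_form_0 de_form_Suc homog_times_d)

text \<open>
  In degree 0 there are no faces, and multiplication by \<open>de\<close> creates none that survive.
\<close>

lemma bar_boundary_de_form: "bar_boundary (de_form e a m) = 0"
proof (induction m)
  case 0
  show ?case by (simp add: bar_boundary_length_one homog_de_form)
next
  case (Suc m)
  then show ?case
    using homog_de_form[of e a m]
    by (cases m) (simp_all add: de_form_Suc bar_boundary_times_d bar_boundary_times_d_0)
qed

lemma left_act_de_form: "left_act z (de_form e a m) = de_form e (z * a) m"
proof (induction m)
  case 0
  show ?case by (simp add: de_form_0 left_act_frag_of)
next
  case (Suc m)
  then show ?case by (simp add: de_form_Suc left_act_times_d[OF homog_de_form])
qed

lemma right_act_de_form:
  assumes "e * e = e"
  shows "right_act e (de_form e a m) =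
    (if even m then de_form e (a * e) m else de_form e a m - de_form e (a * e) m)"
proof (induction m)
  case 0
  show ?case by (simp add: de_form_0 right_act_frag_of)
next
  case (Suc m)
  then show ?case
    by (simp add: de_form_Suc right_act_times_d[OF homog_de_form assms] operators_diff)
qed

text \<open>
  Only the commutator with \<open>e\<close> is left. The parity appears because moving \<open>e\<close> leftwards through
  one factor \<open>de\<close> replaces it by \<open>1 - e\<close>.
\<close>

lemma hochschild_de_form:
  assumes "e * e = e"
  shows "hochschild (de_form e a (Suc m)) =
    (if even m then de_form e (a * e) m - de_form e (e * a) m
     else de_form e (e * a) m - de_form e a m + de_form e (a * e) m)"
  using bar_boundary_de_form[of e a "Suc m"]
  by (simp add: de_form_Suc hochschild_times_d[OF homog_de_form] left_act_de_form
      right_act_de_form[OF assms] frag_cmul_diff2)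

lemma alexander_spanier_de_form:
  "alexander_spanier (de_form e a m) = (times_d e ^^ m) (frag_of [1, a] - frag_of [a, 1])"
proof (induction m)
  case 0
  show ?case by (simp add: de_form_0 alexander_spanier_def)
next
  case (Suc m)
  then show ?case by (simp add: de_form_Suc alexander_spanier_times_d[OF homog_de_form])
qed

section \<open>The tensor relations, generated at the last slot\<close>

context unital_algebra
begin

text \<open>
  The combinations of lists of length \<open>k\<close> that vanish in the tensor power. The defining relators may
  sit in any slot; here they are placed in the last slots and transported by appending further ones, so that
  rule induction matches the rules for operators on \<open>snoc z x\<close>.
\<close>

inductive tensor_null :: "nat \<Rightarrow> ('r list \<Rightarrow>\<^sub>0 int) \<Rightarrow> bool" where
  null_zero: "tensor_null k 0"
| null_diff: "tensor_null k x \<Longrightarrow> tensor_null k y \<Longrightarrow> tensor_null k (x - y)"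
| null_snoc: "tensor_null k x \<Longrightarrow> tensor_null (Suc k) (snoc z x)"
| null_additive: "x \<in> homog k \<Longrightarrow> tensor_null (Suc k) (snoc (a + b) x - snoc a x - snoc b x)"
| null_balanced: "x \<in> homog k \<Longrightarrow>
    tensor_null (Suc (Suc k)) (snoc b (snoc (smul c a) x) - snoc (smul c b) (snoc a x))"

lemma null_minus: "tensor_null k x \<Longrightarrow> tensor_null k (- x)"
  using null_diff[OF null_zero, of k x] by simp

lemma null_add: "tensor_null k x \<Longrightarrow> tensor_null k y \<Longrightarrow> tensor_null k (x + y)"
  using null_diff[OF _ null_minus, of k x y] by simp

lemma null_cmul: "tensor_null k x \<Longrightarrow> tensor_null k (frag_cmul c x)"
  by (rule frag_closure_minus_cmul) (auto intro: null_zero null_diff)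

lemmas null_intros = null_zero null_diff null_minus null_add null_cmul null_snoc

lemma null_homog: "tensor_null k x \<Longrightarrow> x \<in> homog k"
  by (induction rule: tensor_null.induct) (auto intro!: homog_diff homog_snoc)

lemma null_length_zero: "tensor_null 0 x \<Longrightarrow> x = 0"
  by (induction "0::nat" x rule: tensor_null.induct) auto

lemma null_right_act: "tensor_null k x \<Longrightarrow> tensor_null k (right_act z x)"
  by (induction rule: tensor_null.induct)
     (simp_all add: operators_diff right_act_snoc null_intros null_additive null_balanced
        distrib_right scale_mult_left[symmetric])

lemma null_left_act: "tensor_null k x \<Longrightarrow> tensor_null k (left_act z x)"
proof (induction rule: tensor_null.induct)
  case (null_snoc k x y)
  show ?case
  proof (cases k)
    case 0
    then show ?thesis using null_snoc by (auto simp: null_zero dest: null_length_zero)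
  next
    case (Suc j)
    then show ?thesis
      using null_snoc null_homog[OF null_snoc.hyps]
      by (simp add: left_act_snoc tensor_null.null_snoc)
  qed
next
  case (null_additive x k a b)
  then show ?case
    by (cases k)
       (simp_all add: operators_diff left_act_snoc_0 left_act_snoc distrib_left
          tensor_null.null_additive homog_left_act)
next
  case (null_balanced x k b c a)
  then show ?case
    by (cases k)
       (simp_all add: operators_diff left_act_snoc[OF homog_snoc] left_act_snoc_0 left_act_snoc
          scale_mult_right[symmetric] tensor_null.null_balanced homog_left_act)
qed (simp_all add: operators_diff null_intros)

text \<open>
  Inserting \<open>1\<close> elsewhere leaves the relation intact; between two balanced slots it separates them, and
  the scalar passes in two steps.
\<close>

lemma null_alexander_spanier: "tensor_null k x \<Longrightarrow> tensor_null (Suc k) (alexander_spanier x)"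
proof (induction rule: tensor_null.induct)
  case (null_snoc k x z)
  then show ?case
    by (simp add: alexander_spanier_snoc[OF null_homog[OF null_snoc.hyps]] null_intros)
next
  case (null_additive x k a b)
  let ?D = "\<lambda>x. snoc (a + b) x - snoc a x - snoc b x"
  have "alexander_spanier (?D x) = ?D (alexander_spanier x) - frag_cmul ((-1) ^ k) (snoc 1 (?D x))"
    using null_additive
    by (simp add: operators_diff alexander_spanier_snoc frag_cmul_diff2)
  then show ?case
    using tensor_null.null_additive[OF null_additive]
      tensor_null.null_additive[OF homog_alexander_spanier[OF null_additive]]
    by (simp add: null_intros)
next
  case (null_balanced x k b c a)
  let ?B = "\<lambda>b a x. snoc b (snoc (smul c a) x) - snoc (smul c b) (snoc a x)"
  \<comment> \<open>The \<open>1\<close> inserted between the two slots takes over the scalar on its way.\<close>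
  have "alexander_spanier (?B b a x) =
      ?B b a (alexander_spanier x) + frag_cmul ((-1) ^ k) (snoc 1 (?B b a x))
      - frag_cmul ((-1) ^ k) (snoc b (?B 1 a x) + ?B b 1 (snoc a x))"
    using null_balanced
    by (simp add: operators_diff operators_cmul alexander_spanier_snoc alexander_spanier_snoc[OF homog_snoc]
         frag_cmul_diff2 frag_cmul_distrib2 minus_frag_cmul[symmetric] del: minus_frag_cmul)
  moreover have "tensor_null (Suc (Suc (Suc k))) (snoc b (?B 1 a x))"
    "tensor_null (Suc (Suc (Suc k))) (snoc 1 (?B b a x))"
    by (intro null_snoc tensor_null.null_balanced null_balanced)+
  moreover have "tensor_null (Suc (Suc (Suc k))) (?B b 1 (snoc a x))"
    by (intro tensor_null.null_balanced homog_snoc null_balanced)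
  moreover have "tensor_null (Suc (Suc (Suc k))) (?B b a (alexander_spanier x))"
    by (intro tensor_null.null_balanced homog_alexander_spanier null_balanced)
  ultimately show ?case
    by (simp only: null_diff null_add null_cmul)
qed (simp_all add: operators_diff null_intros)

text \<open>
  A face that merges a slot of a relation into its neighbour \<open>x\<close> acts on \<open>x\<close> by that slot, from the right
  or, for the cyclic face, from the left. By bilinearity of the product the relation survives in the
  slot that absorbs it.
\<close>

lemma null_right_act_additive:
  "x \<in> homog (Suc k) \<Longrightarrow> tensor_null (Suc k) (right_act (a + b) x - right_act a x - right_act b x)"
proof (induction x rule: homog_Suc_induct)
  case (snoc z x)
  then show ?case by (simp add: right_act_snoc distrib_left null_additive)
next
  case (diff x y)
  have "right_act (a + b) (x - y) - right_act a (x - y) - right_act b (x - y) =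
    (right_act (a + b) x - right_act a x - right_act b x) -
    (right_act (a + b) y - right_act a y - right_act b y)"
    by (simp add: operators_diff)
  then show ?case using null_diff[OF diff] by simp
qed (simp add: null_zero)

lemma null_right_act_balanced:
  "x \<in> homog (Suc k) \<Longrightarrow>
   tensor_null (Suc (Suc k)) (snoc b (right_act (smul c a) x) - snoc (smul c b) (right_act a x))"
proof (induction x rule: homog_Suc_induct)
  case (snoc z x)
  then show ?case by (simp add: right_act_snoc scale_mult_right[symmetric] null_balanced)
next
  case (diff x y)
  have "snoc b (right_act (smul c a) (x - y)) - snoc (smul c b) (right_act a (x - y)) =
    (snoc b (right_act (smul c a) x) - snoc (smul c b) (right_act a x)) -
    (snoc b (right_act (smul c a) y) - snoc (smul c b) (right_act a y))"
    by (simp add: operators_diff)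
  then show ?case using null_diff[OF diff] by simp
qed (simp add: null_zero)

lemma null_left_act_additive:
  "x \<in> homog (Suc k) \<Longrightarrow> tensor_null (Suc k) (left_act (a + b) x - left_act a x - left_act b x)"
proof (induction k arbitrary: x)
  case 0
  then show ?case
  proof (induction x rule: homog_Suc_induct)
    case (snoc z x)
    then show ?case by (simp add: left_act_snoc_0 distrib_right null_additive)
  next
    case (diff x y)
    have "left_act (a + b) (x - y) - left_act a (x - y) - left_act b (x - y) =
      (left_act (a + b) x - left_act a x - left_act b x) -
      (left_act (a + b) y - left_act a y - left_act b y)"
      by (simp add: operators_diff)
    then show ?case using null_diff[OF diff] by simp
  qed (simp add: null_zero)
next
  case (Suc k)
  note IH = Suc.IH
  from Suc.prems show ?case
  proof (induction x rule: homog_Suc_induct)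
    case (snoc z x)
    then show ?case
      using null_snoc[OF IH[OF snoc], of z] by (simp add: left_act_snoc operators_diff)
  next
    case (diff x y)
    have "left_act (a + b) (x - y) - left_act a (x - y) - left_act b (x - y) =
      (left_act (a + b) x - left_act a x - left_act b x) -
      (left_act (a + b) y - left_act a y - left_act b y)"
      by (simp add: operators_diff)
    then show ?case using null_diff[OF diff] by simp
  qed (simp add: null_zero)
qed

text \<open>
  The cyclic face takes the last of two balanced slots to the front, so the scalar has to travel through
  all the slots of \<open>x\<close>; the induction moves it by one slot at a time.
\<close>

lemma null_left_act_balanced:
  "x \<in> homog (Suc k) \<Longrightarrow>
   tensor_null (Suc (Suc k)) (snoc (smul c a) (left_act b x) - snoc a (left_act (smul c b) x))"
proof (induction k arbitrary: x a)
  case 0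
  then show ?case
  proof (induction x rule: homog_Suc_induct)
    case (snoc z x)
    then show ?case
      using null_minus[OF null_balanced[OF snoc, of a c "b * z"]]
      by (simp add: left_act_snoc_0 scale_mult_left[symmetric])
  next
    case (diff x y)
    have "snoc (smul c a) (left_act b (x - y)) - snoc a (left_act (smul c b) (x - y)) =
      (snoc (smul c a) (left_act b x) - snoc a (left_act (smul c b) x)) -
      (snoc (smul c a) (left_act b y) - snoc a (left_act (smul c b) y))"
      by (simp add: operators_diff)
    then show ?case using null_diff[OF diff] by simp
  qed (simp add: null_zero)
next
  case (Suc k)
  note IH = Suc.IH
  from Suc.prems show ?case
  proof (induction x rule: homog_Suc_induct)
    case (snoc z x)
    have "snoc (smul c a) (left_act b (snoc z x)) - snoc a (left_act (smul c b) (snoc z x)) =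
      snoc a (snoc (smul c z) (left_act b x) - snoc z (left_act (smul c b) x)) -
      (snoc a (snoc (smul c z) (left_act b x)) - snoc (smul c a) (snoc z (left_act b x)))"
      using snoc by (simp add: left_act_snoc operators_diff)
    then show ?case
      using null_diff[OF null_snoc[OF IH[OF snoc], of a z] null_balanced[OF homog_left_act[OF snoc]]]
      by simp
  next
    case (diff x y)
    have "snoc (smul c a) (left_act b (x - y)) - snoc a (left_act (smul c b) (x - y)) =
      (snoc (smul c a) (left_act b x) - snoc a (left_act (smul c b) x)) -
      (snoc (smul c a) (left_act b y) - snoc a (left_act (smul c b) y))"
      by (simp add: operators_diff)
    then show ?case using null_diff[OF diff] by simp
  qed (simp add: null_zero)
qed

text \<open>
  The faces inside \<open>x\<close> keep the relation, the face between \<open>x\<close> and the relation multiplies into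
  it, and the face between two balanced slots gives \<open>(ca) b = a (cb)\<close>.
\<close>

lemma null_bar_boundary: "tensor_null k x \<Longrightarrow> tensor_null (k - 1) (bar_boundary x)"
proof (induction rule: tensor_null.induct)
  case (null_snoc k x z)
  show ?case
  proof (cases k)
    case 0
    then show ?thesis using null_snoc by (auto simp: null_zero dest: null_length_zero)
  next
    case (Suc j)
    then show ?thesis
      using null_snoc null_homog[OF null_snoc.hyps]
      by (simp add: bar_boundary_snoc null_intros null_right_act)
  qed
next
  case (null_additive x k a b)
  show ?case
  proof (cases k)
    case 0
    then have "bar_boundary (snoc (a + b) x - snoc a x - snoc b x) = 0"
      using null_additive by (intro bar_boundary_length_one homog_diff) (simp_all add: homog_snoc)
    then show ?thesis by (simp add: null_zero)
  next
    case (Suc j)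
    have x: "x \<in> homog (Suc j)" using null_additive Suc by simp
    let ?y = "bar_boundary x"
    have "bar_boundary (snoc (a + b) x - snoc a x - snoc b x) =
        (snoc (a + b) ?y - snoc a ?y - snoc b ?y) +
        frag_cmul ((-1) ^ j) (right_act (a + b) x - right_act a x - right_act b x)"
      using x by (simp add: operators_diff bar_boundary_snoc frag_cmul_diff2)
    then show ?thesis
      using tensor_null.null_additive[OF homog_bar_boundary[OF x]] null_right_act_additive[OF x]
      by (simp add: Suc null_add null_cmul)
  qed
next
  case (null_balanced x k b c a)
  have eq: "right_act b (snoc (smul c a) x) = right_act (smul c b) (snoc a x)"
    by (simp add: right_act_snoc scale_mult_left[symmetric] scale_mult_right[symmetric])
  show ?case
  proof (cases k)
    case 0
    then show ?thesis
      using null_balanced eq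
      by (simp add: operators_diff bar_boundary_snoc[OF homog_snoc] bar_boundary_length_one[OF homog_snoc] null_zero)
  next
    case (Suc j)
    have x: "x \<in> homog (Suc j)" using null_balanced Suc by simp
    have "bar_boundary (snoc b (snoc (smul c a) x) - snoc (smul c b) (snoc a x)) =
        (snoc b (snoc (smul c a) (bar_boundary x)) - snoc (smul c b) (snoc a (bar_boundary x))) +
        frag_cmul ((-1) ^ j) (snoc b (right_act (smul c a) x) - snoc (smul c b) (right_act a x))"
      using x eq
      by (simp add: operators_diff operators_add operators_cmul bar_boundary_snoc
          bar_boundary_snoc[OF homog_snoc] frag_cmul_diff2)
    then show ?thesis
      using tensor_null.null_balanced[OF homog_bar_boundary[OF x]] null_right_act_balanced[OF x]
      by (simp add: Suc null_add null_cmul)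
  qed
qed (simp_all add: operators_diff null_intros)

text \<open>
  Relative to the bar boundary only the cyclic face is new. It acts on \<open>x\<close> from the left, and on two
  balanced slots at the end of an otherwise empty list it gives \<open>b (ca) = (cb) a\<close>.
\<close>

lemma null_hochschild: "tensor_null k x \<Longrightarrow> tensor_null (k - 1) (hochschild x)"
proof (induction rule: tensor_null.induct)
  case (null_snoc k x z)
  show ?case
  proof (cases k)
    case 0
    then show ?thesis using null_snoc by (auto simp: null_zero dest: null_length_zero)
  next
    case (Suc j)
    then show ?thesis
      using null_snoc null_homog[OF null_snoc.hyps]
        null_bar_boundary[OF tensor_null.null_snoc[OF null_snoc.hyps], of z]
      by (simp add: hochschild_snoc null_intros null_left_act)
  qed
next
  case (null_additive x k a b)
  show ?case
  proof (cases k)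
    case 0
    then have "hochschild (snoc (a + b) x - snoc a x - snoc b x) = 0"
      using null_additive by (intro hochschild_length_one homog_diff) (simp_all add: homog_snoc)
    then show ?thesis by (simp add: null_zero)
  next
    case (Suc j)
    have x: "x \<in> homog (Suc j)" using null_additive Suc by simp
    have "hochschild (snoc (a + b) x - snoc a x - snoc b x) =
        bar_boundary (snoc (a + b) x - snoc a x - snoc b x) -
        frag_cmul ((-1) ^ j) (left_act (a + b) x - left_act a x - left_act b x)"
      using x by (simp add: operators_diff hochschild_snoc frag_cmul_diff2)
    then show ?thesis
      using null_bar_boundary[OF tensor_null.null_additive[OF x]] null_left_act_additive[OF x]
      by (simp add: Suc null_diff null_cmul)
  qed
next
  case (null_balanced x k b c a)
  let ?\<delta> = "left_act b (snoc (smul c a) x) - left_act (smul c b) (snoc a x)"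
  have "hochschild (snoc b (snoc (smul c a) x) - snoc (smul c b) (snoc a x)) =
      bar_boundary (snoc b (snoc (smul c a) x) - snoc (smul c b) (snoc a x)) - frag_cmul ((-1) ^ k) ?\<delta>"
    using null_balanced by (simp add: operators_diff hochschild_snoc[OF homog_snoc] frag_cmul_diff2)
  moreover have "tensor_null (Suc k) ?\<delta>"
  proof (cases k)
    case 0
    then show ?thesis
      using null_balanced
      by (simp add: left_act_snoc_0 scale_mult_left[symmetric] scale_mult_right[symmetric] null_zero)
  next
    case (Suc j)
    then show ?thesis
      using null_balanced null_left_act_balanced[of x j] by (simp add: left_act_snoc)
  qed
  ultimately show ?case
    using null_bar_boundary[OF tensor_null.null_balanced[OF null_balanced]]
    by (simp add: null_diff null_cmul)
qed (simp_all add: operators_diff null_intros)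

lemma null_times_d: "tensor_null k x \<Longrightarrow> tensor_null (Suc k) (times_d e x)"
proof (cases k)
  case 0
  moreover assume "tensor_null k x"
  ultimately show ?thesis by (auto simp: null_zero dest: null_length_zero)
next
  case (Suc j)
  moreover assume "tensor_null k x"
  ultimately show ?thesis
    using null_homog[of k x] by (simp add: times_d_eq null_intros null_right_act)
qed

end

section \<open>Tensor powers as quotients\<close>

lemma carrier_tensor_free: "carrier (tensor_free n) = homog (Suc n)"
  by (auto simp: tensor_free_def homog_def)

lemma mult_tensor_free: "x \<otimes>\<^bsub>tensor_free n\<^esub> y = x + y"
  by (simp add: tensor_free_def)

lemma zero_in_tensor_kernel: "0 \<in> tensor_kernel smul n"
  using generate.one[of "tensor_free n" "tensor_relators smul n"]
  by (simp add: tensor_kernel_def tensor_free_def)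

lemma relator_in_tensor_kernel: "x \<in> tensor_relators smul n \<Longrightarrow> x \<in> tensor_kernel smul n"
  unfolding tensor_kernel_def by (rule generate.incl)

lemma tensor_relators_homog: "x \<in> tensor_relators smul n \<Longrightarrow> x \<in> homog (Suc n)"
  by (auto simp: tensor_relators_def intro!: homog_diff)

lemma tensor_kernel_induct [consumes 1, case_names relator zero diff]:
  assumes "x \<in> tensor_kernel smul n"
    and rel: "\<And>x. x \<in> tensor_relators smul n \<Longrightarrow> P x"
    and zero: "P 0" and diff: "\<And>x y. P x \<Longrightarrow> P y \<Longrightarrow> P (x - y)"
  shows "P x"
proof -
  have minus: "P (- x)" if "P x" for x
    using diff[OF zero that] by simp
  show ?thesis
    using assms(1) unfolding tensor_kernel_def
  proof (induction rule: generate.induct)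
    case one
    show ?case using zero by (simp add: tensor_free_def)
  next
    case (inv h)
    then have "Poly_Mapping.keys h \<subseteq> {xs. length xs = Suc n}"
      using tensor_relators_homog[of h smul n] by (simp add: homog_def)
    then show ?case using minus[OF rel[OF inv]] by (simp add: tensor_free_def)
  next
    case (eng x y)
    then show ?case using diff[OF _ minus, of x y] by (simp add: mult_tensor_free)
  qed (rule rel)
qed

lemma tensor_kernel_diff:
  assumes "x \<in> tensor_kernel smul n" "y \<in> tensor_kernel smul n"
  shows "x - y \<in> tensor_kernel smul n"
proof -
  have gr: "group (tensor_free n)" "tensor_relators smul n \<subseteq> carrier (tensor_free n)"
    unfolding carrier_tensor_free using tensor_relators_homog by (auto simp: tensor_free_def)
  have "tensor_kernel smul n \<subseteq> homog (Suc n)"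
    using group.generate_incl[OF gr] by (simp add: tensor_kernel_def carrier_tensor_free)
  then have "inv\<^bsub>tensor_free n\<^esub> y = - y"
    using assms(2) by (auto simp: tensor_free_def homog_def)
  moreover have "inv\<^bsub>tensor_free n\<^esub> y \<in> tensor_kernel smul n"
    using group.generate_m_inv_closed[OF gr] assms(2) by (simp add: tensor_kernel_def)
  ultimately show ?thesis
    using generate.eng[of x "tensor_free n" "tensor_relators smul n" "- y"] assms(1)
    by (simp add: tensor_kernel_def mult_tensor_free)
qed

lemma snoc_tensor_relator:
  assumes "x \<in> tensor_relators smul n"
  shows "snoc z x \<in> tensor_relators smul (Suc n)"
proof -
  consider (add) us a b vs where "length us + length vs = n"
      "x = frag_of (us @ [a + b] @ vs) - frag_of (us @ [a] @ vs) - frag_of (us @ [b] @ vs)"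
    | (bal) us c a b vs where "Suc (length us + length vs) = n"
      "x = frag_of (us @ [smul c a, b] @ vs) - frag_of (us @ [a, smul c b] @ vs)"
    using assms by (auto simp: tensor_relators_def)
  then show ?thesis
  proof cases
    case add
    have "\<exists>us a b vs'. snoc z x = frag_of (us @ [a + b] @ vs') - frag_of (us @ [a] @ vs') -
        frag_of (us @ [b] @ vs') \<and> length us + length vs' = Suc n"
      using add by (intro exI[of _ us] exI[of _ a] exI[of _ b] exI[of _ "vs @ [z]"])
        (simp add: operators_diff)
    then show ?thesis unfolding tensor_relators_def by blast
  next
    case bal
    have "\<exists>us c a b vs'. snoc z x = frag_of (us @ [smul c a, b] @ vs') -
        frag_of (us @ [a, smul c b] @ vs') \<and> Suc (length us + length vs') = Suc n"
      using bal by (intro exI[of _ us] exI[of _ c] exI[of _ a] exI[of _ b] exI[of _ "vs @ [z]"])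
        (simp add: operators_diff)
    then show ?thesis unfolding tensor_relators_def by blast
  qed
qed

lemma snoc_tensor_kernel: "x \<in> tensor_kernel smul n \<Longrightarrow> snoc z x \<in> tensor_kernel smul (Suc n)"
proof (induction rule: tensor_kernel_induct)
  case (relator x)
  then show ?case by (simp add: relator_in_tensor_kernel snoc_tensor_relator)
qed (simp_all add: operators_diff tensor_kernel_diff zero_in_tensor_kernel)

lemma additive_in_tensor_kernel:
  "x \<in> homog n \<Longrightarrow> snoc (a + b) x - snoc a x - snoc b x \<in> tensor_kernel smul n"
proof (induction x rule: homog_induct)
  case (one xs)
  then have "snoc (a + b) (frag_of xs) - snoc a (frag_of xs) - snoc b (frag_of xs)
      \<in> tensor_relators smul n"
    unfolding tensor_relators_def
    by (intro UnI1 CollectI exI[of _ xs] exI[of _ a] exI[of _ b] exI[of _ "[]"]) simp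
  then show ?case by (rule relator_in_tensor_kernel)
next
  case (diff x y)
  then show ?case
    using tensor_kernel_diff[OF diff] by (simp add: operators_diff algebra_simps)
qed (simp add: zero_in_tensor_kernel)

lemma balanced_in_tensor_kernel:
  "x \<in> homog n \<Longrightarrow>
   snoc b (snoc (smul c a) x) - snoc (smul c b) (snoc a x) \<in> tensor_kernel smul (Suc n)"
proof (induction x rule: homog_induct)
  case (one xs)
  then have "snoc b (snoc (smul c a) (frag_of xs)) - snoc (smul c b) (snoc a (frag_of xs))
      \<in> tensor_relators smul (Suc n)"
    unfolding tensor_relators_def
    by (intro UnI2 CollectI exI[of _ xs] exI[of _ c] exI[of _ a] exI[of _ b] exI[of _ "[]"]) simp
  then show ?case by (rule relator_in_tensor_kernel)
next
  case (diff x y)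
  then show ?case
    using tensor_kernel_diff[OF diff] by (simp add: operators_diff algebra_simps)
qed (simp add: zero_in_tensor_kernel)

context unital_algebra
begin

lemma tensor_null_relator:
  assumes "x \<in> tensor_relators smul n"
  shows "tensor_null (Suc n) x"
proof -
  have add: "tensor_null (Suc (length us + length vs))
      (frag_of (us @ [a + b] @ vs) - frag_of (us @ [a] @ vs) - frag_of (us @ [b] @ vs))" for us a b vs
  proof (induction vs rule: rev_induct)
    case Nil
    show ?case using null_additive[of "frag_of us" "length us" a b] by simp
  next
    case (snoc v vs)
    show ?case using null_snoc[OF snoc, of v] by (simp add: operators_diff)
  qed
  have bal: "tensor_null (Suc (Suc (length us + length vs)))
      (frag_of (us @ [smul c a, b] @ vs) - frag_of (us @ [a, smul c b] @ vs))" for us c a b vs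
  proof (induction vs rule: rev_induct)
    case Nil
    show ?case using null_balanced[of "frag_of us" "length us" b c a] by simp
  next
    case (snoc v vs)
    show ?case using null_snoc[OF snoc, of v] by (simp add: operators_diff)
  qed
  show ?thesis
    using assms add bal unfolding tensor_relators_def by fastforce
qed

text \<open>
  A relator in the middle of a list is one in the last slots with the remaining slots appended;
  conversely the kernel is closed under appending. Length 0 has no counterpart among the kernels, and
  there only \<open>0\<close> vanishes.
\<close>

lemma tensor_kernel_iff: "x \<in> tensor_kernel smul n \<longleftrightarrow> tensor_null (Suc n) x"
proof
  assume "x \<in> tensor_kernel smul n"
  then show "tensor_null (Suc n) x"
    by (induction rule: tensor_kernel_induct) (auto intro: tensor_null_relator null_intros)
next
  have "case k of 0 \<Rightarrow> y = 0 | Suc n \<Rightarrow> y \<in> tensor_kernel smul n" if "tensor_null k y" for k y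
    using that
  proof (induction rule: tensor_null.induct)
    case (null_snoc k x z)
    then show ?case
      by (cases k rule: nat.exhaust) (simp_all add: snoc_tensor_kernel zero_in_tensor_kernel)
  qed (simp_all add: zero_in_tensor_kernel tensor_kernel_diff
        additive_in_tensor_kernel balanced_in_tensor_kernel split: nat.splits)
  from this[of "Suc n" x] show "tensor_null (Suc n) x \<Longrightarrow> x \<in> tensor_kernel smul n"
    by simp
qed

definition tensor_eq :: "nat \<Rightarrow> ('r list \<Rightarrow>\<^sub>0 int) \<Rightarrow> ('r list \<Rightarrow>\<^sub>0 int) \<Rightarrow> bool" where
  "tensor_eq k x y \<longleftrightarrow> tensor_null k (x - y)"

lemma tensor_eq_refl [simp]: "tensor_eq k x x"
  by (simp add: tensor_eq_def null_zero)

lemma tensor_eq_sym: "tensor_eq k x y \<Longrightarrow> tensor_eq k y x"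
  unfolding tensor_eq_def using null_minus[of k "x - y"] by simp

lemma tensor_eq_trans [trans]: "tensor_eq k x y \<Longrightarrow> tensor_eq k y z \<Longrightarrow> tensor_eq k x z"
  unfolding tensor_eq_def using null_add[of k "x - y" "y - z"] by simp

lemma tensor_eq_diff:
  "tensor_eq k x x' \<Longrightarrow> tensor_eq k y y' \<Longrightarrow> tensor_eq k (x - y) (x' - y')"
  unfolding tensor_eq_def using null_diff[of k "x - x'" "y - y'"] by (simp add: algebra_simps)

lemma tensor_eq_add:
  "tensor_eq k x x' \<Longrightarrow> tensor_eq k y y' \<Longrightarrow> tensor_eq k (x + y) (x' + y')"
  unfolding tensor_eq_def using null_add[of k "x - x'" "y - y'"] by (simp add: algebra_simps)

lemma tensor_eq_cmul: "tensor_eq k x y \<Longrightarrow> tensor_eq k (frag_cmul c x) (frag_cmul c y)"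
  unfolding tensor_eq_def using null_cmul[of k "x - y" c] by (simp add: frag_cmul_diff2)

lemma tensor_eq_sum:
  "(\<And>i. i \<in> I \<Longrightarrow> tensor_eq k (f i) (g i)) \<Longrightarrow> tensor_eq k (sum f I) (sum g I)"
  by (induction I rule: infinite_finite_induct) (auto intro: tensor_eq_add)

lemma tensor_eq_hochschild: "tensor_eq (Suc k) x y \<Longrightarrow> tensor_eq k (hochschild x) (hochschild y)"
  unfolding tensor_eq_def using null_hochschild[of "Suc k" "x - y"] by (simp add: operators_diff)

lemma tensor_eq_alexander_spanier:
  "tensor_eq k x y \<Longrightarrow> tensor_eq (Suc k) (alexander_spanier x) (alexander_spanier y)"
  unfolding tensor_eq_def using null_alexander_spanier[of k "x - y"] by (simp add: operators_diff)

lemma chain_class_eq: "chain_class smul n x = {y. tensor_eq (Suc n) y x}"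
proof -
  have "y \<in> chain_class smul n x \<longleftrightarrow> tensor_eq (Suc n) y x" for y
    unfolding chain_class_def r_coset_def mult_tensor_free tensor_eq_def
    by (auto simp flip: tensor_kernel_iff intro!: bexI[of _ "y - x"])
  then show ?thesis by blast
qed

lemma chain_class_eqI: "tensor_eq (Suc n) x y \<Longrightarrow> chain_class smul n x = chain_class smul n y"
  unfolding chain_class_eq using tensor_eq_trans tensor_eq_sym by blast

lemma chain_class_zero: "\<one>\<^bsub>chain_group smul n\<^esub> = chain_class smul n 0"
  by (auto simp: chain_group_def chain_class_eq tensor_eq_def tensor_kernel_iff)

lemma chain_class_add:
  "chain_class smul n x \<otimes>\<^bsub>chain_group smul n\<^esub> chain_class smul n y = chain_class smul n (x + y)"
proof -
  have "z \<in> chain_class smul n x <#>\<^bsub>tensor_free n\<^esub> chain_class smul n y" if "tensor_eq (Suc n) z (x + y)" for z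
  proof -
    have "tensor_eq (Suc n) (z - y) x"
      using tensor_eq_diff[OF that tensor_eq_refl[of _ y]] by simp
    then show ?thesis
      unfolding set_mult_def mult_tensor_free chain_class_eq
      by (intro UN_I[of "z - y"] UN_I[of y]) simp_all
  qed
  then show ?thesis
    by (auto simp: chain_group_def set_mult_def mult_tensor_free chain_class_eq intro: tensor_eq_add)
qed

lemma chain_class_in_carrier:
  "x \<in> homog (Suc n) \<Longrightarrow> chain_class smul n x \<in> carrier (chain_group smul n)"
  by (auto simp: chain_group_def carrier_FactGroup chain_class_def carrier_tensor_free)

lemma induced_chain_class:
  assumes "\<And>y. tensor_eq (Suc n) y x \<Longrightarrow> tensor_eq (Suc m) (f y) (f x)"
  shows "induced smul m f (chain_class smul n x) = chain_class smul m (f x)"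
proof -
  have "chain_class smul m (f y) = chain_class smul m (f x)" if "y \<in> chain_class smul n x" for y
    using that assms by (intro chain_class_eqI) (simp add: chain_class_eq)
  moreover have "x \<in> chain_class smul n x" by (simp add: chain_class_eq)
  ultimately show ?thesis unfolding induced_def by blast
qed

lemma tensor_eq_db:
  "tensor_eq (Suc k) x y \<Longrightarrow>
   tensor_eq (Suc k) (((alexander_spanier \<circ> hochschild) ^^ j) x) (((alexander_spanier \<circ> hochschild) ^^ j) y)"
  by (induction j) (auto intro: tensor_eq_alexander_spanier tensor_eq_hochschild)

lemma tensor_eq_mod_hochschild:
  "tensor_eq (Suc k) x y \<Longrightarrow> tensor_eq k (mod_hochschild n x) (mod_hochschild n y)"
  unfolding mod_hochschild_def
  by (intro tensor_eq_hochschild tensor_eq_sum tensor_eq_cmul tensor_eq_db)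

lemma tensor_eq_sigma: "tensor_eq (Suc k) x y \<Longrightarrow> tensor_eq (Suc k) (sigma x) (sigma y)"
  unfolding sigma_def
  by (intro tensor_eq_diff tensor_eq_add tensor_eq_hochschild tensor_eq_alexander_spanier)

lemma tensor_eq_funpow_sigma:
  "tensor_eq (Suc k) x y \<Longrightarrow> tensor_eq (Suc k) ((sigma ^^ j) x) ((sigma ^^ j) y)"
  by (induction j) (auto intro: tensor_eq_sigma)

lemma tensor_eq_normaliser:
  "tensor_eq (Suc k) x y \<Longrightarrow> tensor_eq (Suc k) (normaliser n x) (normaliser n y)"
  unfolding normaliser_def
  by (intro tensor_eq_diff tensor_eq_hochschild tensor_eq_alexander_spanier tensor_eq_funpow_sigma)

section \<open>Boundaries of the scaled forms\<close>

lemma tensor_eq_times_d: "tensor_eq k x y \<Longrightarrow> tensor_eq (Suc k) (times_d e x) (times_d e y)"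
  unfolding tensor_eq_def using null_times_d[of k "x - y"] by (simp add: operators_diff)

lemma tensor_eq_funpow_times_d:
  "tensor_eq k x y \<Longrightarrow> tensor_eq (k + m) ((times_d e ^^ m) x) ((times_d e ^^ m) y)"
  by (induction m) (auto intro: tensor_eq_times_d)

lemma tensor_eq_balanced: "tensor_eq 2 (frag_of [smul c a, b]) (frag_of [a, smul c b])"
  using null_balanced[of "frag_of []" 0 b c a] by (simp add: tensor_eq_def numeral_2_eq_2)

text \<open>
  Here a tensor relation is needed: \<open>d (ce) = 1 \<otimes> ce - ce \<otimes> 1\<close> becomes \<open>c de = c1 \<otimes> e - ce \<otimes> 1\<close>
  only after moving the scalar to the first slot.
\<close>

lemma alexander_spanier_scaled_de_form:
  "tensor_eq (m + 2) (alexander_spanier (de_form e (smul c e) m)) (de_form e (smul c 1) (Suc m))"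
proof -
  have "times_d e (frag_of [smul c 1]) = frag_of [smul c 1, e] - frag_of [smul c e, 1]"
    using times_d_eq[of "frag_of [smul c 1]" 0 e]
    by (simp add: right_act_frag_of scale_mult_left[symmetric])
  then have "tensor_eq 2 (frag_of [1, smul c e] - frag_of [smul c e, 1]) (times_d e (frag_of [smul c 1]))"
    by (simp add: tensor_eq_diff tensor_eq_sym[OF tensor_eq_balanced])
  from tensor_eq_funpow_times_d[OF this, of m e] show ?thesis
    unfolding alexander_spanier_de_form
    by (simp add: de_form_def funpow_Suc_right add.commute del: funpow.simps)
qed

lemma alexander_spanier_scaled_de_power:
  "tensor_eq (m + 2) (alexander_spanier (de_form e (smul c 1) m)) 0"
proof -
  have "tensor_eq 2 (frag_of [1, smul c 1] - frag_of [smul c 1, 1]) 0"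
    using tensor_eq_diff[OF tensor_eq_balanced[of c 1 1] tensor_eq_refl[of _ "frag_of [1, smul c 1]"]]
      tensor_eq_sym
    by (metis (no_types) tensor_eq_balanced tensor_eq_diff tensor_eq_refl cancel_comm_monoid_add_class.diff_cancel)
  moreover have "(times_d e ^^ m) 0 = 0"
    by (induction m) simp_all
  ultimately show ?thesis
    using tensor_eq_funpow_times_d[of 2 _ 0 m e] by (simp add: alexander_spanier_de_form add.commute)
qed

lemma de_form_additive: "tensor_eq (Suc m) (de_form e (a + b) m) (de_form e a m + de_form e b m)"
proof (induction m)
  case 0
  show ?case
    using null_additive[of "frag_of []" 0 a b] by (simp add: de_form_0 tensor_eq_def algebra_simps)
next
  case (Suc m)
  then show ?case using tensor_eq_times_d[OF Suc, of e] by (simp add: de_form_Suc operators_add)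
qed

lemma de_form_zero: "tensor_eq (Suc m) (de_form e 0 m) 0"
  using tensor_eq_diff[OF de_form_additive[of m e 0 0] tensor_eq_refl[of _ "de_form e 0 m"]] tensor_eq_sym
  by simp

lemma de_form_of_nat:
  "tensor_eq (Suc m) (frag_cmul (int n) (de_form e (smul c a) m)) (de_form e (smul (of_nat n * c) a) m)"
proof (induction n)
  case 0
  show ?case using tensor_eq_sym[OF de_form_zero] by simp
next
  case (Suc n)
  have "frag_cmul (int (Suc n)) (de_form e (smul c a) m) =
      de_form e (smul c a) m + frag_cmul (int n) (de_form e (smul c a) m)"
    by (simp add: frag_cmul_distrib)
  moreover have "tensor_eq (Suc m) (de_form e (smul c a) m + frag_cmul (int n) (de_form e (smul c a) m))
      (de_form e (smul c a) m + de_form e (smul (of_nat n * c) a) m)"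
    by (intro tensor_eq_add tensor_eq_refl Suc)
  moreover have "smul (of_nat (Suc n) * c) a = smul c a + smul (of_nat n * c) a"
    by (simp add: distrib_right scale_left_distrib)
  ultimately show ?case
    using tensor_eq_trans tensor_eq_sym[OF de_form_additive] by metis
qed

context
  fixes e :: 'r and c :: 'k
  assumes idem: "e * e = e"
begin

lemma scaled_idempotent [simp]:
  "smul c e * e = smul c e" "e * smul c e = smul c e" "smul c 1 * e = smul c e" "e * smul c 1 = smul c e"
  by (simp_all add: scale_mult_left[symmetric] scale_mult_right[symmetric] idem)

abbreviation "\<omega> \<equiv> de_form e (smul c e)"
abbreviation "\<eta> \<equiv> de_form e (smul c 1)"

lemma hochschild_\<omega>: "hochschild (\<omega> (Suc m)) = (if even m then 0 else \<omega> m)"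
  by (simp add: hochschild_de_form[OF idem])

lemma hochschild_\<eta>: "hochschild (\<eta> (Suc m)) = (if even m then 0 else frag_cmul 2 (\<omega> m) - \<eta> m)"
  using frag_cmul_distrib[of 1 1 "\<omega> m"] by (simp add: hochschild_de_form[OF idem])

lemma db_\<omega>: "even m \<Longrightarrow> 0 < m \<Longrightarrow> tensor_eq (Suc m) (alexander_spanier (hochschild (\<omega> m))) (\<eta> m)"
  using alexander_spanier_scaled_de_form[of "m - 1" e c] hochschild_\<omega>[of "m - 1"]
  by (cases m) auto

lemma db_\<eta>: "even m \<Longrightarrow> 0 < m \<Longrightarrow>
   tensor_eq (Suc m) (alexander_spanier (hochschild (\<eta> m))) (frag_cmul 2 (\<eta> m))"
proof (cases m)
  case (Suc j)
  moreover assume "even m"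
  ultimately have "alexander_spanier (hochschild (\<eta> m)) =
      frag_cmul 2 (alexander_spanier (\<omega> j)) - alexander_spanier (\<eta> j)"
    by (simp add: hochschild_\<eta> operators_diff operators_cmul)
  moreover have "tensor_eq (Suc m) (frag_cmul 2 (alexander_spanier (\<omega> j)) - alexander_spanier (\<eta> j))
      (frag_cmul 2 (\<eta> m) - 0)"
    using alexander_spanier_scaled_de_form[of j e c] alexander_spanier_scaled_de_power[of j e c]
    unfolding Suc by (intro tensor_eq_diff tensor_eq_cmul) simp_all
  ultimately show ?thesis by simp
qed simp

text \<open>
  One application of \<open>db\<close> leads from \<open>\<omega>\<close> to \<open>\<eta>\<close>, an eigenvector for the eigenvalue 2.
\<close>

lemma db_power_\<omega>:
  assumes "even m" "0 < m"
  shows "tensor_eq (Suc m) (((alexander_spanier \<circ> hochschild) ^^ Suc j) (\<omega> m)) (frag_cmul (2 ^ j) (\<eta> m))"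
proof (induction j)
  case 0
  show ?case using db_\<omega>[OF assms] by simp
next
  case (Suc j)
  have "tensor_eq (Suc m) (((alexander_spanier \<circ> hochschild) ^^ Suc (Suc j)) (\<omega> m))
      (alexander_spanier (hochschild (frag_cmul (2 ^ j) (\<eta> m))))"
    using tensor_eq_alexander_spanier[OF tensor_eq_hochschild[OF Suc]] by (simp add: comp_def)
  also have "alexander_spanier (hochschild (frag_cmul (2 ^ j) (\<eta> m))) =
      frag_cmul (2 ^ j) (alexander_spanier (hochschild (\<eta> m)))"
    by (simp add: operators_cmul)
  also have "tensor_eq (Suc m) \<dots> (frag_cmul (2 ^ j) (frag_cmul 2 (\<eta> m)))"
    by (intro tensor_eq_cmul db_\<eta> assms)
  finally show ?case by (simp add: mult.commute)
qed

end

section \<open>The modified boundary and the normalisation\<close>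

lemma frag_cmul_sum_left: "frag_cmul (sum f I) x = (\<Sum>i\<in>I. frag_cmul (f i) x)"
  by (induction I rule: infinite_finite_induct) (simp_all add: frag_cmul_distrib)

text \<open>
  Up to the factor \<open>-4\<close> this is the expansion of \<open>(1 - 2)\<^sup>2\<^sup>n = 1\<close> without its first two terms.
\<close>

lemma alternating_binomial_sum:
  "(\<Sum>k=2..2 * n. (-1) ^ (k - 1) * int (2 * n choose k) * 2 ^ (k - 2)) = - int n"
proof (cases n)
  case (Suc n')
  let ?f = "\<lambda>k. int (2 * n choose k) * (-2) ^ k"
  have "0 = (\<Sum>k\<le>2 * n. ?f k) - 1"
    using binomial_ring[of "-2::int" 1 "2 * n"] by simp
  also have "{..2 * n} = {0, 1} \<union> {2..2 * n}"
    using Suc by auto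
  also have "sum ?f ({0, 1} \<union> {2..2 * n}) = 1 - 4 * int n + (\<Sum>k=2..2 * n. ?f k)"
    by (subst sum.union_disjoint) auto
  also have "(\<Sum>k=2..2 * n. ?f k) =
      (\<Sum>k=2..2 * n. (-4) * ((-1) ^ (k - 1) * int (2 * n choose k) * 2 ^ (k - 2)))"
  proof (rule sum.cong[OF refl])
    fix k assume "k \<in> {2..2 * n}"
    then obtain j where "k = Suc (Suc j)"
      using le_Suc_ex[of 2 k] by auto
    then show "?f k = (-4) * ((-1) ^ (k - 1) * int (2 * n choose k) * 2 ^ (k - 2))"
      using power_mult_distrib[of "-1::int" 2 j] by simp
  qed
  finally show ?thesis by (simp only: sum_distrib_left[symmetric])
qed simp

text \<open>
  The term \<open>k = 1\<close> of the modified boundary contributes \<open>2n \<omega>\<close>; the others are multiples of \<open>\<eta>\<close>, and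
  their coefficients add up to \<open>-n\<close>. The boundary of \<open>2n \<omega> - n \<eta>\<close> then loses its \<open>\<omega>\<close> part.
\<close>

lemma mod_hochschild_\<omega>:
  assumes idem: "e * e = e" and n: "0 < n"
  shows "tensor_eq (2 * n) (mod_hochschild (2 * n) (de_form e (smul c e) (2 * n)))
    (frag_cmul (int n) (de_form e (smul c 1) (2 * n - 1)))"
proof -
  let ?\<omega> = "de_form e (smul c e)" and ?\<eta> = "de_form e (smul c 1)"
  let ?t = "\<lambda>k. frag_cmul ((-1) ^ (k - 1) * int (2 * n choose k))
      (((alexander_spanier \<circ> hochschild) ^^ (k - 1)) (?\<omega> (2 * n)))"
  have "{1..2 * n} = insert 1 {2..2 * n}"
    using n by auto
  then have "(\<Sum>k=1..2 * n. ?t k) = frag_cmul (2 * int n) (?\<omega> (2 * n)) + (\<Sum>k=2..2 * n. ?t k)"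
    by simp
  moreover have "tensor_eq (Suc (2 * n)) (\<Sum>k=2..2 * n. ?t k)
      (\<Sum>k=2..2 * n. frag_cmul ((-1) ^ (k - 1) * int (2 * n choose k) * 2 ^ (k - 2)) (?\<eta> (2 * n)))"
  proof (rule tensor_eq_sum)
    fix k assume "k \<in> {2..2 * n}"
    then obtain j where k: "k = Suc (Suc j)"
      using le_Suc_ex[of 2 k] by auto
    have "tensor_eq (Suc (2 * n)) (?t k)
        (frag_cmul ((-1) ^ (k - 1) * int (2 * n choose k)) (frag_cmul (2 ^ j) (?\<eta> (2 * n))))"
      using db_power_\<omega>[OF idem, where m = "2 * n" and c = c and j = j] n
      unfolding k by (intro tensor_eq_cmul) simp
    then show "tensor_eq (Suc (2 * n)) (?t k)
        (frag_cmul ((-1) ^ (k - 1) * int (2 * n choose k) * 2 ^ (k - 2)) (?\<eta> (2 * n)))"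
      by (simp add: k)
  qed
  moreover have "(\<Sum>k=2..2 * n. frag_cmul ((-1) ^ (k - 1) * int (2 * n choose k) * 2 ^ (k - 2)) (?\<eta> (2 * n)))
      = frag_cmul (- int n) (?\<eta> (2 * n))"
    unfolding frag_cmul_sum_left[symmetric] alternating_binomial_sum ..
  ultimately have "tensor_eq (Suc (2 * n)) (\<Sum>k=1..2 * n. ?t k)
      (frag_cmul (2 * int n) (?\<omega> (2 * n)) + frag_cmul (- int n) (?\<eta> (2 * n)))"
    using tensor_eq_add[OF tensor_eq_refl] by simp
  then have "tensor_eq (2 * n) (mod_hochschild (2 * n) (?\<omega> (2 * n)))
      (hochschild (frag_cmul (2 * int n) (?\<omega> (2 * n)) + frag_cmul (- int n) (?\<eta> (2 * n))))"
    unfolding mod_hochschild_def by (rule tensor_eq_hochschild)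
  also have "hochschild (frag_cmul (2 * int n) (?\<omega> (2 * n)) + frag_cmul (- int n) (?\<eta> (2 * n)))
      = frag_cmul (int n) (?\<eta> (2 * n - 1))"
    using hochschild_\<omega>[OF idem, where m = "2 * n - 1" and c = c]
      hochschild_\<eta>[OF idem, where m = "2 * n - 1" and c = c] n
    by (simp add: operators_add operators_diff operators_cmul frag_cmul_diff2 mult.commute
        minus_frag_cmul[symmetric] del: minus_frag_cmul)
  finally show ?thesis .
qed

text \<open>
  For positive \<open>n\<close> the operator \<open>\<sigma>\<close> sends \<open>\<omega>\<close> to \<open>\<omega> - \<eta>\<close> and \<open>\<eta>\<close> to \<open>-\<eta>\<close>, so its square fixes \<open>\<omega>\<close>. For
  \<open>n = 0\<close> the power of \<open>\<sigma>\<close> is the identity by definition.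
\<close>

lemma normaliser_\<omega>:
  assumes idem: "e * e = e"
  shows "tensor_eq (Suc (2 * n)) (normaliser (2 * n) (de_form e (smul c e) (2 * n)))
    (de_form e (smul c e) (2 * n))"
proof -
  let ?\<omega> = "de_form e (smul c e) (2 * n)" and ?\<eta> = "de_form e (smul c 1) (2 * n)"
  have bd_\<omega>: "tensor_eq (Suc (2 * n)) (hochschild (alexander_spanier ?\<omega>)) 0"
    using tensor_eq_hochschild[of "Suc (2 * n)", OF alexander_spanier_scaled_de_form[of "2 * n" e c, simplified]]
    by (simp add: hochschild_\<eta>[OF idem])
  have bd_\<eta>: "tensor_eq (Suc (2 * n)) (hochschild (alexander_spanier ?\<eta>)) 0"
    using tensor_eq_hochschild[of "Suc (2 * n)", OF alexander_spanier_scaled_de_power[of "2 * n" e c, simplified]]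
    by simp
  have sigma_sigma: "tensor_eq (Suc (2 * n)) (sigma (sigma ?\<omega>)) ?\<omega>" if "0 < n"
  proof -
    have \<omega>: "tensor_eq (Suc (2 * n)) (sigma ?\<omega>) (?\<omega> - (?\<eta> + 0))"
      unfolding sigma_def
      using that by (intro tensor_eq_diff tensor_eq_add tensor_eq_refl db_\<omega>[OF idem] bd_\<omega>) auto
    have \<eta>: "tensor_eq (Suc (2 * n)) (sigma ?\<eta>) (?\<eta> - (frag_cmul 2 ?\<eta> + 0))"
      unfolding sigma_def
      using that by (intro tensor_eq_diff tensor_eq_add tensor_eq_refl db_\<eta>[OF idem] bd_\<eta>) auto
    have "tensor_eq (Suc (2 * n)) (sigma (sigma ?\<omega>)) (sigma (?\<omega> - ?\<eta>))"
      using tensor_eq_sigma[OF \<omega>] by simp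
    also have "sigma (?\<omega> - ?\<eta>) = sigma ?\<omega> - sigma ?\<eta>"
      by (simp add: sigma_def operators_diff)
    also have "tensor_eq (Suc (2 * n)) \<dots> ((?\<omega> - (?\<eta> + 0)) - (?\<eta> - (frag_cmul 2 ?\<eta> + 0)))"
      by (intro tensor_eq_diff \<omega> \<eta>)
    also have "(?\<omega> - (?\<eta> + 0)) - (?\<eta> - (frag_cmul 2 ?\<eta> + 0)) = ?\<omega>"
      using frag_cmul_distrib[of 1 1 ?\<eta>] by simp
    finally show ?thesis .
  qed
  have "tensor_eq (Suc (2 * n)) ((sigma ^^ (2 * j)) ?\<omega>) ?\<omega>" if "0 < n" for j
  proof (induction j)
    case (Suc j)
    then show ?case
      using tensor_eq_trans[OF tensor_eq_sigma[OF tensor_eq_sigma[OF Suc]] sigma_sigma[OF that]]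
      by simp
  qed simp
  then have \<omega>: "tensor_eq (Suc (2 * n)) ((sigma ^^ (2 * n)) ?\<omega>) ?\<omega>"
    by (cases "n = 0") auto
  then have "tensor_eq (Suc (2 * n)) (normaliser (2 * n) ?\<omega>) (?\<omega> - hochschild (alexander_spanier ?\<omega>))"
    unfolding normaliser_def
    by (intro tensor_eq_diff tensor_eq_hochschild tensor_eq_alexander_spanier)
  also have "tensor_eq (Suc (2 * n)) \<dots> (?\<omega> - 0)"
    by (intro tensor_eq_diff tensor_eq_refl bd_\<omega>)
  finally show ?thesis by simp
qed

section \<open>The Chern character\<close>

lemma chain_scale_times_d:
  "x \<in> homog (Suc k) \<Longrightarrow> chain_scale smul c (times_d e x) = times_d e (chain_scale smul c x)"
proof (induction x rule: homog_induct)
  case (one xs)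
  have "length (smul c (hd xs) # tl xs) = Suc k"
    using one by simp
  then show ?case
    using one times_d_eq[of "frag_of xs" k e] times_d_eq[of "frag_of (smul c (hd xs) # tl xs)" k e]
    by (cases xs)
       (auto simp: chain_scale_def frag_extend_diff right_act_frag_of scale_mult_left)
qed (simp_all add: operators_diff chain_scale_def frag_extend_diff)

text \<open>
  The first slot carries the scalar and \<open>de\<close> multiplies at the last, so the scaled form is the form with
  scaled coefficient.
\<close>

lemma chain_scale_e_de_power: "chain_scale smul c (e_de_power e m) = de_form e (smul c e) m"
proof -
  have eq: "e_de_power e m = de_form e e m" for m
    by (simp add: e_de_power_def de_form_def times_d_def[abs_def])
  show ?thesis unfolding eq
  proof (induction m)
    case 0
    show ?case by (simp add: de_form_0 chain_scale_def)
  next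
    case (Suc m)
    then show ?case by (simp add: de_form_Suc chain_scale_times_d[OF homog_de_form])
  qed
qed

lemma chern_even:
  "chern \<iota> smul e (2 * n) = chain_class smul (2 * n) (de_form e (smul (\<iota> ((-1) ^ n / fact n)) e) (2 * n))"
  by (simp add: chern_def chain_scale_e_de_power)

lemma chern_odd: "odd m \<Longrightarrow> chern \<iota> smul e m = chain_class smul m 0"
  by (simp add: chern_def chain_class_zero)

lemma chern_coefficients:
  assumes "rat_embedding \<iota>"
  shows "of_nat (Suc n) * \<iota> ((-1) ^ Suc n / fact (Suc n)) + \<iota> ((-1) ^ n / fact n) = (0 :: 'k)"
proof -
  have add: "\<iota> (p + q) = \<iota> p + \<iota> q" for p q
    using assms by (simp add: rat_embedding_def)
  have zero: "\<iota> 0 = 0"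
    using add[of 0 0] by simp
  have "of_nat k * \<iota> p = \<iota> (of_nat k * p)" for k p
    by (induction k) (simp_all add: zero add distrib_right)
  then have "of_nat (Suc n) * \<iota> ((-1) ^ Suc n / fact (Suc n)) + \<iota> ((-1) ^ n / fact n) =
      \<iota> (of_nat (Suc n) * ((-1) ^ Suc n / fact (Suc n)) + (-1) ^ n / fact n)"
    by (simp only: add)
  also have "of_nat (Suc n) * ((-1) ^ Suc n / fact (Suc n)) + (-1) ^ n / fact n = (0 :: rat)"
    by (simp add: field_simps del: of_nat_Suc)
  finally show ?thesis using zero by simp
qed

text \<open>
  The modified boundary of degree \<open>2n + 2\<close> is \<open>(n + 1) c (de)\<^sup>2\<^sup>n\<^sup>+\<^sup>1\<close> with the coefficient
  \<open>c\<close> of index \<open>n + 1\<close>, the co-boundary of degree \<open>2n\<close> is the same power with the coefficient of index \<open>n\<close>.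
\<close>

lemma total_boundary_chern_odd:
  assumes "rat_embedding \<iota>" and idem: "e * e = e"
  shows "total_boundary smul (chern \<iota> smul e) (Suc (2 * n)) = \<one>\<^bsub>chain_group smul (Suc (2 * n))\<^esub>"
proof -
  let ?c = "\<lambda>n. \<iota> ((-1) ^ n / fact n)"
  let ?\<omega> = "\<lambda>n. de_form e (smul (?c n) e) (2 * n)"
  let ?\<eta> = "\<lambda>c. de_form e (smul c 1) (Suc (2 * n))"
  have "tensor_eq (Suc (Suc (2 * n))) (mod_hochschild (2 * Suc n) (?\<omega> (Suc n)))
      (frag_cmul (int (Suc n)) (?\<eta> (?c (Suc n))))"
    using mod_hochschild_\<omega>[OF idem, of "Suc n" "?c (Suc n)"] by simp
  also have "tensor_eq (Suc (Suc (2 * n))) \<dots> (?\<eta> (of_nat (Suc n) * ?c (Suc n)))"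
    by (rule de_form_of_nat)
  finally have "tensor_eq (Suc (Suc (2 * n)))
      (mod_hochschild (2 * Suc n) (?\<omega> (Suc n)) + alexander_spanier (?\<omega> n))
      (?\<eta> (of_nat (Suc n) * ?c (Suc n)) + ?\<eta> (?c n))"
    using alexander_spanier_scaled_de_form[of "2 * n" e "?c n"] by (intro tensor_eq_add) simp_all
  also have "tensor_eq (Suc (Suc (2 * n))) \<dots> (?\<eta> (of_nat (Suc n) * ?c (Suc n) + ?c n))"
    using tensor_eq_sym[OF de_form_additive] by (simp only: scale_left_distrib)
  also have "tensor_eq (Suc (Suc (2 * n))) \<dots> 0"
    unfolding chern_coefficients[OF assms(1)] by (simp add: de_form_zero)
  finally have eq: "tensor_eq (Suc (Suc (2 * n)))
      (mod_hochschild (2 * Suc n) (?\<omega> (Suc n)) + alexander_spanier (?\<omega> n)) 0" .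
  have "induced smul (Suc (2 * n)) (mod_hochschild (2 * Suc n)) (chern \<iota> smul e (2 * Suc n)) =
      chain_class smul (Suc (2 * n)) (mod_hochschild (2 * Suc n) (?\<omega> (Suc n)))"
    unfolding chern_even by (intro induced_chain_class tensor_eq_mod_hochschild) simp
  moreover have "induced smul (Suc (2 * n)) alexander_spanier (chern \<iota> smul e (2 * n)) =
      chain_class smul (Suc (2 * n)) (alexander_spanier (?\<omega> n))"
    unfolding chern_even by (intro induced_chain_class tensor_eq_alexander_spanier)
  ultimately show ?thesis
    using chain_class_eqI[OF eq]
    by (simp add: total_boundary_def chain_class_add chain_class_zero)
qed

lemma total_boundary_chern_even:
  assumes "even m"
  shows "total_boundary smul (chern \<iota> smul e) m = \<one>\<^bsub>chain_group smul m\<^esub>"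
proof -
  have "mod_hochschild k (0 :: 'r list \<Rightarrow>\<^sub>0 int) = 0" for k :: nat
  proof -
    have "((alexander_spanier \<circ> hochschild) ^^ j) 0 = (0 :: 'r list \<Rightarrow>\<^sub>0 int)" for j
      by (induction j) simp_all
    then show ?thesis by (simp add: mod_hochschild_def)
  qed
  then have b: "induced smul m (mod_hochschild (Suc m)) (chern \<iota> smul e (Suc m)) = chain_class smul m 0"
    using induced_chain_class[of "Suc m" 0 m "mod_hochschild (Suc m)"] tensor_eq_mod_hochschild[of "Suc m" _ 0]
      assms
    by (simp add: chern_odd)
  have d: "induced smul m alexander_spanier (chern \<iota> smul e (m - 1)) = chain_class smul m 0" if pos: "m \<noteq> 0"
  proof -
    obtain k where m: "m = Suc k"
      using pos by (cases m) auto
    then show ?thesis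
      using induced_chain_class[of k 0 m alexander_spanier] tensor_eq_alexander_spanier[of m _ 0] assms
      by (simp add: chern_odd)
  qed
  show ?thesis
    using b d by (simp add: total_boundary_def chain_class_zero chain_class_add)
qed

theorem chern_character_cycle:
  assumes "rat_embedding \<iota>" and idem: "e * e = e"
  shows "total_cycle smul True (chern \<iota> smul e)"
proof -
  have "chern \<iota> smul e (2 * n) \<in> normalised_chains smul (2 * n)" for n
  proof -
    let ?\<omega> = "de_form e (smul (\<iota> ((-1) ^ n / fact n)) e) (2 * n)"
    have "induced smul (2 * n) (normaliser (2 * n)) (chain_class smul (2 * n) ?\<omega>) =
        chain_class smul (2 * n) (normaliser (2 * n) ?\<omega>)"
      by (intro induced_chain_class tensor_eq_normaliser)
    also have "\<dots> = chain_class smul (2 * n) ?\<omega>"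
      by (intro chain_class_eqI normaliser_\<omega> idem)
    finally show ?thesis
      unfolding normalised_chains_def chern_even
      by (intro image_eqI[of _ _ "chain_class smul (2 * n) ?\<omega>"])
         (simp_all add: chain_class_in_carrier homog_de_form)
  qed
  then have "chern \<iota> smul e \<in> total_complex smul True"
    by (auto simp: total_complex_def chern_odd chain_class_zero elim!: evenE)
  moreover have "total_boundary smul (chern \<iota> smul e) m = \<one>\<^bsub>chain_group smul m\<^esub>" for m
    using total_boundary_chern_even[of m \<iota> e] total_boundary_chern_odd[OF assms, of "m div 2"]
    by (cases "even m") (auto elim!: oddE)
  ultimately show ?thesis
    by (simp add: total_cycle_def)
qed

end

theorem theorem77:
  fixes \<iota> :: "rat \<Rightarrow> 'k::comm_ring_1"
    and smul :: "'k \<Rightarrow> 'a::ring_1 \<Rightarrow> 'a"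
    and filt :: "nat \<Rightarrow> 'a set"
    and e :: "('a, 'n::finite) sqmat"
  assumes "rat_embedding \<iota>"
    and "localised_ring smul filt"
    and "e * e = e"
  shows "total_cycle (mat_scale smul) True (chern \<iota> (mat_scale smul) e)"
proof -
  have "unital_algebra smul"
    using assms(2) by (rule localised_ring.axioms(1))
  then interpret unital_algebra "mat_scale smul :: 'k \<Rightarrow> ('a, 'n) sqmat \<Rightarrow> _"
    by (rule unital_algebra_mat_scale)
  show ?thesis
    using assms(1,3) by (rule chern_character_cycle)
qed

end
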